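(* Let $\vec p=(p_1,\dots,p_n)$ with $1<\vec p<\infty$ and let $1<\frac{n}{\sum_{i=1}^n 1/p_i}<t<r<\infty$. Then $M_{\vec p}^{t,r}$ is reflexive.
   Context: Functions are complex-valued and measurable on $\mathbb R^n$, identified when equal almost everywhere. Inequalities for vectors are componentwise. Mixed Lebesgue space: $L^{\vec p}$ is the set of measurable $f$ with $$\|f\|_{L^{\vec p}}=\Big(\int_{\mathbb R}\cdots\Big(\int_{\mathbb R}|f(x_1,\dots,x_n)|^{p_1}dx_1\Big)^{p_2/p_1}\cdots dx_n\Big)^{1/p_n}<\infty.$$ $\mathcal D$ is the family of all dyadic cubes $\prod_{i=1}^n[2^{-j}m_i,2^{-j}(m_i+1))$, $j\in\mathbb Z$, $m\in\mathbb Z^n$. Mixed Bourgain-Morrey space: $M_{\vec p}^{t,r}$ is the set of measurable $f$ with $$\|f\|_{M_{\vec p}^{t,r}}=\Big(\sum_{Q\in\mathcal D}|Q|^{\frac rt-\frac rn\sum_{i=1}^n\frac1{p_i}}\|f\chi_Q\|_{L^{\vec p}}^r\Big)^{1/r}<\infty.$$ *)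

theory Defs
  imports "HOL-Analysis.Analysis" "HOL-Algebra.Module"
begin

section \<open>Complex normed spaces on a carrier, duals and reflexivity\<close>

definition complex_field :: "complex ring" where
  "complex_field = \<lparr>carrier = UNIV, mult = (*), one = 1, zero = 0, add = (+)\<rparr>"

text \<open>A record is used because the underlying set of the function space below depends on
  real parameters and cannot be a type. Scalars are complex. The fields \<open>mult\<close> and \<open>one\<close>
  inherited from the module record play no role.\<close>

record 'a normed_module = "(complex, 'a) module" +
  vnorm :: "'a \<Rightarrow> real"

definition complex_normed_space :: "('a, 'm) normed_module_scheme \<Rightarrow> bool" where
  "complex_normed_space X \<longleftrightarrow>
     Module.module complex_field X \<and>
     (\<forall>x\<in>carrier X. 0 \<le> vnorm X x \<and> (vnorm X x = 0 \<longleftrightarrow> x = \<zero>\<^bsub>X\<^esub>)) \<and>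
     (\<forall>c. \<forall>x\<in>carrier X. vnorm X (c \<odot>\<^bsub>X\<^esub> x) = cmod c * vnorm X x) \<and>
     (\<forall>x\<in>carrier X. \<forall>y\<in>carrier X. vnorm X (x \<oplus>\<^bsub>X\<^esub> y) \<le> vnorm X x + vnorm X y)"

text \<open>Functionals live on the carrier; outside of it they are fixed to \<open>undefined\<close>, so that
  equality of functionals is equality on the carrier.\<close>

definition bounded_functionals :: "('a, 'm) normed_module_scheme \<Rightarrow> ('a \<Rightarrow> complex) set" where
  "bounded_functionals X =
     {\<phi> \<in> extensional (carrier X).
        (\<forall>x\<in>carrier X. \<forall>y\<in>carrier X. \<phi> (x \<oplus>\<^bsub>X\<^esub> y) = \<phi> x + \<phi> y) \<and>
        (\<forall>c. \<forall>x\<in>carrier X. \<phi> (c \<odot>\<^bsub>X\<^esub> x) = c * \<phi> x) \<and>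
        (\<exists>B. \<forall>x\<in>carrier X. cmod (\<phi> x) \<le> B * vnorm X x)}"

definition dual_space ::
    "('a, 'm) normed_module_scheme \<Rightarrow> ('a \<Rightarrow> complex) normed_module" where
  "dual_space X =
     \<lparr>carrier = bounded_functionals X,
      mult = undefined,
      one = undefined,
      zero = (\<lambda>x\<in>carrier X. 0),
      add = (\<lambda>\<phi> \<psi>. \<lambda>x\<in>carrier X. \<phi> x + \<psi> x),
      smult = (\<lambda>c \<phi>. \<lambda>x\<in>carrier X. c * \<phi> x),
      vnorm = (\<lambda>\<phi>. SUP x\<in>{x \<in> carrier X. vnorm X x \<le> 1}. cmod (\<phi> x))\<rparr>"

definition canonical_embedding ::
    "('a, 'm) normed_module_scheme \<Rightarrow> 'a \<Rightarrow> ('a \<Rightarrow> complex) \<Rightarrow> complex" where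
  "canonical_embedding X x = (\<lambda>\<phi>\<in>carrier (dual_space X). \<phi> x)"

definition reflexive_space :: "('a, 'm) normed_module_scheme \<Rightarrow> bool" where
  "reflexive_space X \<longleftrightarrow>
     complex_normed_space X \<and>
     canonical_embedding X ` carrier X = carrier (dual_space (dual_space X))"

section \<open>Mixed Lebesgue norms\<close>

text \<open>Points of \<open>n\<close>-dimensional space are the functions in
  \<open>PiE {1..n} (\<lambda>_. UNIV)\<close>, with coordinates \<open>x 1, \<dots>, x n\<close>; the measure is
  \<open>n\<close>-dimensional Lebesgue measure on the Lebesgue measurable sets.\<close>

definition lebesgue_n :: "nat \<Rightarrow> (nat \<Rightarrow> real) measure" where
  "lebesgue_n n = completion (PiM {1..n} (\<lambda>_. lborel))"

text \<open>Real powers on \<open>[0, \<infinity>]\<close>, used for positive exponents only.\<close>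

definition epowr :: "ennreal \<Rightarrow> real \<Rightarrow> ennreal" where
  "epowr x a = (if x = \<infinity> then \<infinity> else ennreal (enn2real x powr a))"

text \<open>\<open>iterated_norm p f k\<close> takes the \<open>L\<^bsup>p 1\<^esup>\<close> norm of \<open>f\<close> in the first coordinate, then the
  \<open>L\<^bsup>p 2\<^esup>\<close> norm of the result in the second one, and so on up to the \<open>k\<close>-th; it is a function of
  the remaining coordinates. Two successive exponents \<open>1 / p k\<close> and \<open>p (k + 1)\<close> combine to
  the usual \<open>p (k + 1) / p k\<close>.\<close>

primrec iterated_norm ::
    "(nat \<Rightarrow> real) \<Rightarrow> ((nat \<Rightarrow> real) \<Rightarrow> complex) \<Rightarrow> nat \<Rightarrow> (nat \<Rightarrow> real) \<Rightarrow> ennreal" where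
  "iterated_norm p f 0 x = ennreal (cmod (f x))"
| "iterated_norm p f (Suc k) x =
     epowr (\<integral>\<^sup>+ y. epowr (iterated_norm p f k (x(Suc k := y))) (p (Suc k)) \<partial>lebesgue)
           (1 / p (Suc k))"

text \<open>After all \<open>n\<close> coordinates are integrated out, the starting point only serves to give the
  value \<open>undefined\<close> outside \<open>{1..n}\<close>, as required of the elements of \<open>PiE {1..n}\<close>.\<close>

definition mixed_Lp_norm ::
    "nat \<Rightarrow> (nat \<Rightarrow> real) \<Rightarrow> ((nat \<Rightarrow> real) \<Rightarrow> complex) \<Rightarrow> ennreal" where
  "mixed_Lp_norm n p f = iterated_norm p f n (\<lambda>_. undefined)"

section \<open>Mixed Bourgain-Morrey spaces\<close>

definition dyadic_cube :: "nat \<Rightarrow> int \<Rightarrow> (nat \<Rightarrow> int) \<Rightarrow> (nat \<Rightarrow> real) set" where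
  "dyadic_cube n j m =
     (\<Pi>\<^sub>E i\<in>{1..n}. {2 powi (- j) * real_of_int (m i) ..< 2 powi (- j) * (real_of_int (m i) + 1)})"

definition dyadic_cubes :: "nat \<Rightarrow> (nat \<Rightarrow> real) set set" where
  "dyadic_cubes n = {dyadic_cube n j m | j m. True}"

definition bourgain_morrey_norm ::
    "nat \<Rightarrow> (nat \<Rightarrow> real) \<Rightarrow> real \<Rightarrow> real \<Rightarrow> ((nat \<Rightarrow> real) \<Rightarrow> complex) \<Rightarrow> ennreal" where
  "bourgain_morrey_norm n p t r f =
     epowr
       (\<Sum>\<^sub>\<infinity>Q\<in>dyadic_cubes n.
          ennreal (measure (lebesgue_n n) Q powr (r / t - r / real n * (\<Sum>i=1..n. 1 / p i))) *
          epowr (mixed_Lp_norm n p (\<lambda>x. f x * indicator Q x)) r)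
       (1 / r)"

definition bourgain_morrey_functions ::
    "nat \<Rightarrow> (nat \<Rightarrow> real) \<Rightarrow> real \<Rightarrow> real \<Rightarrow> ((nat \<Rightarrow> real) \<Rightarrow> complex) set" where
  "bourgain_morrey_functions n p t r =
     {f \<in> borel_measurable (lebesgue_n n). bourgain_morrey_norm n p t r f < \<infinity>}"

definition ae_rel ::
    "nat \<Rightarrow> (((nat \<Rightarrow> real) \<Rightarrow> complex) \<times> ((nat \<Rightarrow> real) \<Rightarrow> complex)) set" where
  "ae_rel n =
     {(f, g). f \<in> borel_measurable (lebesgue_n n) \<and> g \<in> borel_measurable (lebesgue_n n) \<and>
              (AE x in lebesgue_n n. f x = g x)}"

text \<open>The normed space of almost-everywhere classes; the operations and the norm are those of
  arbitrary representatives.\<close>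

definition mixed_bourgain_morrey ::
    "nat \<Rightarrow> (nat \<Rightarrow> real) \<Rightarrow> real \<Rightarrow> real \<Rightarrow> ((nat \<Rightarrow> real) \<Rightarrow> complex) set normed_module" where
  "mixed_bourgain_morrey n p t r =
     \<lparr>carrier = bourgain_morrey_functions n p t r // ae_rel n,
      mult = undefined,
      one = undefined,
      zero = ae_rel n `` {\<lambda>_. 0},
      add = (\<lambda>A B. \<Union>f\<in>A. \<Union>g\<in>B. ae_rel n `` {\<lambda>x. f x + g x}),
      smult = (\<lambda>c A. \<Union>f\<in>A. ae_rel n `` {\<lambda>x. c * f x}),
      vnorm = (\<lambda>A. enn2real (the_elem (bourgain_morrey_norm n p t r ` A)))\<rparr>"

end

theory Submission
  imports Defs
begin

text \<open>
  The space is reflexive because it is a uniformly convex Banach space, and uniformly convex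
  Banach spaces are reflexive by the theorem of Milman and Pettis.

  Uniform convexity is handled through an inequality between powers of norms that is stable
  under integration. Write \<open>a, b, m, d\<close> for the norms of \<open>f\<close>, \<open>g\<close>, \<open>(f + g) / 2\<close> and \<open>f - g\<close>.
  A family of such quadruples is \<open>power_convex\<close> with exponent \<open>p\<close> if for every \<open>e > 0\<close> there is
  a \<open>C\<close> with
  \<open>d\<^sup>p \<le> e (a\<^sup>p + b\<^sup>p) + C ((a\<^sup>p + b\<^sup>p) / 2 - m\<^sup>p)\<close>
  throughout the family. For complex numbers and \<open>p = 2\<close> this is the parallelogram law. If the
  inequality holds at every point with exponent \<open>p\<close>, integrating it gives the same inequality for
  the \<open>L\<^sup>p\<close> norms. By homogeneity and compactness, it holds either for all exponents
  \<open>q > 1\<close> or for none (\<open>power_convex_change_exponent\<close>). Alternating these two steps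
  carries the inequality through the successive norms in \<open>x\<^sub>1, \<dots>, x\<^sub>n\<close> and then through the
  \<open>\<ell>\<^sup>r\<close> sum over the dyadic cubes, which is one more \<open>L\<^sup>r\<close> norm, over a weighted
  counting measure. On the unit ball the resulting inequality with exponent \<open>r\<close> is uniform
  convexity.

  Completeness is the argument of Riesz and Fischer. It rests on countable subadditivity of the
  norm, which is Minkowski's inequality for series, again applied one coordinate at a
  time and once more over the cubes.

  The Milman-Pettis theorem (\<open>milman_pettis\<close>) is proved by constructing the representing vector
  as the limit of a sequence. A functional \<open>F\<close> of norm one on the dual nearly attains
  its norm at some \<open>\<phi>\<^sub>k\<close> in the dual unit ball, with errors tending to zero. Vectors of the
  unit ball at which \<open>\<phi>\<^sub>k\<close> is nearly one lie close together by uniform convexity, so they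
  converge to a vector \<open>x\<close>. Applying \<open>F\<close> to small perturbations \<open>\<phi>\<^sub>k + t \<psi>\<close> shows that
  \<open>F \<psi> = \<psi> x\<close> for every \<open>\<psi>\<close>.
\<close>

section \<open>Powers and integral norms on the extended half-line\<close>

lemma epowr_ennreal: "0 \<le> x \<Longrightarrow> epowr (ennreal x) a = ennreal (x powr a)"
  by (simp add: epowr_def)

lemma epowr_top [simp]: "epowr top_class.top a = top_class.top"
  by (simp add: epowr_def)

lemma epowr_0 [simp]: "epowr 0 a = 0"
  by (simp add: epowr_def)

lemma epowr_1 [simp]: "epowr x 1 = x"
  by (cases x) (auto simp: epowr_ennreal)

lemma epowr_epowr: "epowr (epowr x a) b = epowr x (a * b)"
  by (cases x) (auto simp: epowr_ennreal powr_powr)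

lemma epowr_mono: "0 \<le> a \<Longrightarrow> x \<le> y \<Longrightarrow> epowr x a \<le> epowr y a"
  by (cases x; cases y) (auto simp: epowr_ennreal top_unique intro!: ennreal_leI powr_mono2)

lemma epowr_eq_0_iff [simp]: "epowr x a = 0 \<longleftrightarrow> x = 0"
  by (cases x) (auto simp: epowr_ennreal)

lemma epowr_mult: "epowr (x * y) a = epowr x a * epowr y a"
proof (cases "x = \<infinity> \<or> y = \<infinity>")
  case True
  then show ?thesis
    by (cases "x = 0"; cases "y = 0") (auto simp: ennreal_mult_top ennreal_top_mult)
next
  case False
  then show ?thesis
    by (cases x; cases y) (auto simp: epowr_ennreal powr_mult simp flip: ennreal_mult)
qed

lemma epowr_measurable [measurable (raw)]:
  assumes [measurable]: "f \<in> borel_measurable M"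
  shows "(\<lambda>x. epowr (f x) a) \<in> borel_measurable M"
  unfolding epowr_def by measurable

text \<open>Strictness is what makes \<open>L\<^sup>p\<close> norms rotund. With \<open>A = 1 + (x\<^sup>q - 1) / q\<close>, the
  weighted mean of \<open>x\<^sup>q\<close> and \<open>1\<close>, the claim is the inequality \<open>x < A\<close> between the
  geometric and the arithmetic mean. It follows from \<open>ln z \<le> z - 1\<close> at
  \<open>z = x\<^sup>q / A\<close> and at \<open>z = 1 / A\<close>, the latter being strict unless \<open>A = 1\<close>.\<close>

lemma bernoulli_powr_strict:
  fixes x q :: real
  assumes "0 \<le> x" "x \<noteq> 1" "1 < q"
  shows "1 + q * (x - 1) < x powr q"
proof (cases "x = 0")
  case True with assms show ?thesis by simp
next
  case False
  with assms have x: "x > 0" by simp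
  define A where "A = 1 + (x powr q - 1) / q"
  have "0 < (q - 1 + x powr q) / q" using assms by (intro divide_pos_pos add_pos_nonneg) auto
  also have "\<dots> = A" using assms by (simp add: A_def field_simps)
  finally have A: "0 < A" .
  have "A \<noteq> 1"
  proof
    assume "A = 1"
    then have "x powr q = 1" using assms by (simp add: A_def)
    then have "x = 1" using x assms by (simp add: powr_eq_one_iff_gen)
    with assms show False by simp
  qed
  then have "ln (1 / A) \<noteq> 1 / A - 1" using ln_eq_minus_one[of "1 / A"] A by auto
  then have 1: "- ln A < 1 / A - 1" using ln_le_minus_one[of "1 / A"] A by (simp add: ln_div)
  have 2: "q * ln x - ln A \<le> x powr q / A - 1"
    using ln_le_minus_one[of "x powr q / A"] A x by (simp add: ln_div ln_powr)
  have "(q - 1) * (- ln A) < (q - 1) * (1 / A - 1)" using 1 assms by (intro mult_strict_left_mono) auto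
  then have "q * (ln x - ln A) < (q - 1 + x powr q) / A - q"
    using 2 by (simp add: algebra_simps add_divide_distrib diff_divide_distrib)
  also have "q - 1 + x powr q = q * A" using assms by (simp add: A_def field_simps)
  finally have "q * (ln x - ln A) < 0" using A by simp
  then have "ln x < ln A" using assms by (simp add: mult_less_0_iff)
  then have "x < A" using A x by simp
  then have "q * x < q * A" using assms by (intro mult_strict_left_mono) auto
  also have "q * A = q - 1 + x powr q" using assms by (simp add: A_def field_simps)
  finally show ?thesis by (simp add: algebra_simps)
qed

lemma bernoulli_powr: "0 \<le> x \<Longrightarrow> 1 < q \<Longrightarrow> 1 + q * (x - 1) \<le> x powr q" for x q :: real
  using bernoulli_powr_strict[of x q] by (cases "x = 1") auto

text \<open>Bernoulli's inequality is the tangent line at \<open>1\<close>. Dividing by the value \<open>c\<close> of the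
  combination moves the point of tangency there, and the linear terms cancel. Unlike
  \<open>powr_convex\<close>, this covers the endpoint \<open>0\<close>.\<close>

lemma powr_convex_combination:
  fixes x y s t q :: real
  assumes "0 \<le> x" "0 \<le> y" "0 \<le> s" "0 \<le> t" "s + t = 1" "1 < q"
  shows "(s * x + t * y) powr q \<le> s * x powr q + t * y powr q"
proof (cases "s * x + t * y = 0")
  case True with assms show ?thesis by simp
next
  case False
  define c where "c = s * x + t * y"
  have c: "c > 0" using False assms by (simp add: c_def order_less_le)
  have "s * (1 + q * (x / c - 1)) + t * (1 + q * (y / c - 1)) \<le> s * (x / c) powr q + t * (y / c) powr q"
    using assms c by (intro add_mono mult_left_mono bernoulli_powr) auto
  also have "s * (1 + q * (x / c - 1)) + t * (1 + q * (y / c - 1)) = (s + t) * (1 - q) + q * ((s * x + t * y) / c)"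
    by (simp add: algebra_simps add_divide_distrib)
  also have "\<dots> = 1" using assms c by (simp add: c_def[symmetric])
  also have "s * (x / c) powr q + t * (y / c) powr q = (s * x powr q + t * y powr q) / c powr q"
    using assms c by (simp add: powr_divide add_divide_distrib)
  finally show ?thesis using c by (simp add: c_def field_simps)
qed

lemma powr_mean_strict:
  fixes x y q :: real
  assumes "0 \<le> x" "0 \<le> y" "x \<noteq> y" "1 < q"
  shows "((x + y) / 2) powr q < (x powr q + y powr q) / 2"
proof -
  define c where "c = (x + y) / 2"
  have c: "c > 0" using assms by (simp add: c_def)
  have "x / c \<noteq> 1" "y / c \<noteq> 1" using assms c by (auto simp: c_def field_simps)
  then have "(1 + q * (x / c - 1)) + (1 + q * (y / c - 1)) < (x / c) powr q + (y / c) powr q"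
    using assms c by (intro add_strict_mono bernoulli_powr_strict) auto
  also have "(1 + q * (x / c - 1)) + (1 + q * (y / c - 1)) = 2 * (1 - q) + q * ((x + y) / c)"
    by (simp add: algebra_simps add_divide_distrib)
  also have "x + y = 2 * c" by (simp add: c_def)
  also have "(x / c) powr q + (y / c) powr q = (x powr q + y powr q) / c powr q"
    using assms c by (simp add: powr_divide add_divide_distrib)
  finally have "2 < (x powr q + y powr q) / c powr q" using c by simp
  then show ?thesis using c by (simp add: c_def field_simps)
qed

definition Lp_norm :: "'a measure \<Rightarrow> real \<Rightarrow> ('a \<Rightarrow> ennreal) \<Rightarrow> ennreal" where
  "Lp_norm M p u = epowr (\<integral>\<^sup>+ y. epowr (u y) p \<partial>M) (1 / p)"

lemma epowr_Lp_norm: "p \<noteq> 0 \<Longrightarrow> epowr (Lp_norm M p u) p = (\<integral>\<^sup>+ y. epowr (u y) p \<partial>M)"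
  by (simp add: Lp_norm_def epowr_epowr)

lemma Lp_norm_mono_AE:
  "0 < p \<Longrightarrow> AE y in M. u y \<le> v y \<Longrightarrow> Lp_norm M p u \<le> Lp_norm M p v"
  unfolding Lp_norm_def by (intro epowr_mono nn_integral_mono_AE) (auto elim!: eventually_mono intro: epowr_mono)

lemma Lp_norm_mono:
  "0 < p \<Longrightarrow> (\<And>y. y \<in> space M \<Longrightarrow> u y \<le> v y) \<Longrightarrow> Lp_norm M p u \<le> Lp_norm M p v"
  by (rule Lp_norm_mono_AE) auto

lemma Lp_norm_cong_AE:
  "AE y in M. u y = v y \<Longrightarrow> Lp_norm M p u = Lp_norm M p v"
  unfolding Lp_norm_def
  by (intro arg_cong[where f = "\<lambda>z. epowr z (1 / p)"] nn_integral_cong_AE) (auto elim!: eventually_mono)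

lemma Lp_norm_cmult:
  assumes "u \<in> borel_measurable M" "p \<noteq> 0"
  shows "Lp_norm M p (\<lambda>y. c * u y) = c * Lp_norm M p u"
  using assms by (simp add: Lp_norm_def epowr_mult nn_integral_cmult epowr_epowr)

lemma Lp_norm_eq_0_iff:
  assumes "u \<in> borel_measurable M"
  shows "Lp_norm M p u = 0 \<longleftrightarrow> (AE y in M. u y = 0)"
  using assms by (simp add: Lp_norm_def nn_integral_0_iff_AE)

text \<open>If the norms \<open>a\<close>, \<open>b\<close> are positive and finite, then \<open>(u + v) / (a + b)\<close> is a
  convex combination of \<open>u / a\<close> and \<open>v / b\<close> with weights \<open>a / (a + b)\<close> and
  \<open>b / (a + b)\<close>; integrating the convexity of the \<open>p\<close>-th power gives the claim.\<close>

lemma minkowski: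
  assumes p: "1 < p" and [measurable]: "u \<in> borel_measurable M" "v \<in> borel_measurable M"
  shows "Lp_norm M p (\<lambda>y. u y + v y) \<le> Lp_norm M p u + Lp_norm M p v"
proof -
  consider "Lp_norm M p u = 0" | "Lp_norm M p v = 0" | "Lp_norm M p u = \<infinity>" | "Lp_norm M p v = \<infinity>"
    | a b where "Lp_norm M p u = ennreal a" "Lp_norm M p v = ennreal b" "0 < a" "0 < b"
    by (cases "Lp_norm M p u"; cases "Lp_norm M p v") (auto simp: less_le)
  then show ?thesis
  proof cases
    case 1
    then have "AE y in M. u y = 0" by (simp add: Lp_norm_eq_0_iff)
    then have "Lp_norm M p (\<lambda>y. u y + v y) = Lp_norm M p v" by (intro Lp_norm_cong_AE) (auto elim!: eventually_mono)
    then show ?thesis by simp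
  next
    case 2
    then have "AE y in M. v y = 0" by (simp add: Lp_norm_eq_0_iff)
    then have "Lp_norm M p (\<lambda>y. u y + v y) = Lp_norm M p u" by (intro Lp_norm_cong_AE) (auto elim!: eventually_mono)
    then show ?thesis by simp
  next
    case (5 a b)
    define s where "s = a + b"
    have s: "s > 0" using 5 by (simp add: s_def)
    define c d where "c = s powr p * (a / s) / a powr p" and "d = s powr p * (b / s) / b powr p"
    have cd: "c > 0" "d > 0" using 5 s by (auto simp: c_def d_def)
    have pointwise: "epowr (x + y) p \<le> ennreal c * epowr x p + ennreal d * epowr y p" for x y
    proof (cases "x = \<infinity> \<or> y = \<infinity>")
      case True then show ?thesis using cd by (auto simp: ennreal_mult_top)
    next
      case False
      then obtain \<xi> \<eta> where *: "x = ennreal \<xi>" "y = ennreal \<eta>" "0 \<le> \<xi>" "0 \<le> \<eta>" by (cases x; cases y) auto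
      have "(\<xi> + \<eta>) powr p = (s * ((a / s) * (\<xi> / a) + (b / s) * (\<eta> / b))) powr p"
        using 5 s by (simp add: distrib_left)
      also have "\<dots> = s powr p * ((a / s) * (\<xi> / a) + (b / s) * (\<eta> / b)) powr p"
        using 5 s * by (intro powr_mult)
      also have "\<dots> \<le> s powr p * ((a / s) * (\<xi> / a) powr p + (b / s) * (\<eta> / b) powr p)"
        using 5 s * p by (intro mult_left_mono powr_convex_combination) (auto simp: s_def simp flip: add_divide_distrib)
      also have "\<dots> = c * \<xi> powr p + d * \<eta> powr p"
        using 5 s * by (simp add: powr_divide c_def d_def algebra_simps)
      finally show ?thesis using * cd
        by (simp add: epowr_ennreal ennreal_leI flip: ennreal_plus ennreal_mult)
    qed
    have "epowr (Lp_norm M p (\<lambda>y. u y + v y)) p = (\<integral>\<^sup>+ y. epowr (u y + v y) p \<partial>M)"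
      using p by (simp add: epowr_Lp_norm)
    also have "\<dots> \<le> (\<integral>\<^sup>+ y. ennreal c * epowr (u y) p + ennreal d * epowr (v y) p \<partial>M)"
      by (intro nn_integral_mono pointwise)
    also have "\<dots> = ennreal c * epowr (Lp_norm M p u) p + ennreal d * epowr (Lp_norm M p v) p"
      using p by (simp add: nn_integral_add nn_integral_cmult epowr_Lp_norm)
    also have "\<dots> = ennreal (c * a powr p + d * b powr p)"
      using 5 cd by (simp add: epowr_ennreal ennreal_mult)
    also have "c * a powr p + d * b powr p = s powr p * ((a + b) / s)"
      using 5 by (simp add: c_def d_def add_divide_distrib algebra_simps)
    also have "\<dots> = s powr p" using s by (simp add: s_def)
    finally have "epowr (epowr (Lp_norm M p (\<lambda>y. u y + v y)) p) (1 / p) \<le> epowr (ennreal (s powr p)) (1 / p)"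
      using p by (intro epowr_mono) auto
    then show ?thesis using p s 5 by (simp add: epowr_epowr epowr_ennreal powr_powr s_def)
  qed auto
qed

text \<open>The finite case passes to the limit by monotone convergence. This form is what
  completeness rests on.\<close>

lemma minkowski_suminf:
  assumes p: "1 < p" and u: "\<And>j. u j \<in> borel_measurable M"
  shows "Lp_norm M p (\<lambda>y. \<Sum>j. u j y) \<le> (\<Sum>j::nat. Lp_norm M p (u j))"
proof -
  note [measurable] = u
  have fin: "Lp_norm M p (\<lambda>y. \<Sum>j<n. u j y) \<le> (\<Sum>j<n. Lp_norm M p (u j))" for n
  proof (induction n)
    case 0 then show ?case by (simp add: Lp_norm_def)
  next
    case (Suc n)
    have "Lp_norm M p (\<lambda>y. (\<Sum>j<n. u j y) + u n y) \<le> Lp_norm M p (\<lambda>y. \<Sum>j<n. u j y) + Lp_norm M p (u n)"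
      by (rule minkowski[OF p]) measurable
    also have "\<dots> \<le> (\<Sum>j<n. Lp_norm M p (u j)) + Lp_norm M p (u n)" by (intro add_right_mono Suc)
    finally show ?case by simp
  qed
  define S where "S = (\<Sum>j. Lp_norm M p (u j))"
  have part: "(\<integral>\<^sup>+ y. epowr (\<Sum>j<n. u j y) p \<partial>M) \<le> epowr S p" for n
  proof -
    have "(\<integral>\<^sup>+ y. epowr (\<Sum>j<n. u j y) p \<partial>M) = epowr (Lp_norm M p (\<lambda>y. \<Sum>j<n. u j y)) p"
      using p by (simp add: epowr_Lp_norm)
    also have "\<dots> \<le> epowr S p" unfolding S_def
      using p by (intro epowr_mono order_trans[OF fin] sum_le_suminf) auto
    finally show ?thesis .
  qed
  \<comment> \<open>Continuity of the power along increasing sums, obtained from its inverse being monotone.\<close>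
  have sup: "epowr (\<Sum>j. u j y) p \<le> (SUP n. epowr (\<Sum>j<n. u j y) p)" for y
  proof -
    let ?z = "SUP n. epowr (\<Sum>j<n. u j y) p"
    have "(\<Sum>j<n. u j y) \<le> epowr ?z (1 / p)" for n
    proof -
      have "epowr (epowr (\<Sum>j<n. u j y) p) (1 / p) \<le> epowr ?z (1 / p)"
        using p by (intro epowr_mono SUP_upper) auto
      then show ?thesis using p by (simp add: epowr_epowr)
    qed
    then have "(\<Sum>j. u j y) \<le> epowr ?z (1 / p)"
      unfolding suminf_eq_SUP by (intro SUP_least)
    then have "epowr (\<Sum>j. u j y) p \<le> epowr (epowr ?z (1 / p)) p" using p by (intro epowr_mono) auto
    then show ?thesis using p by (simp add: epowr_epowr)
  qed
  have inc: "incseq (\<lambda>n y. epowr (\<Sum>j<n. u j y) p)"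
    using p by (intro incseq_SucI le_funI epowr_mono) auto
  have "(\<integral>\<^sup>+ y. epowr (\<Sum>j. u j y) p \<partial>M) \<le> (\<integral>\<^sup>+ y. (SUP n. epowr (\<Sum>j<n. u j y) p) \<partial>M)"
    by (intro nn_integral_mono sup)
  also have "\<dots> = (SUP n. \<integral>\<^sup>+ y. epowr (\<Sum>j<n. u j y) p \<partial>M)"
    by (intro nn_integral_monotone_convergence_SUP inc) measurable
  also have "\<dots> \<le> epowr S p" by (intro SUP_least part)
  finally have "Lp_norm M p (\<lambda>y. \<Sum>j. u j y) \<le> epowr (epowr S p) (1 / p)"
    unfolding Lp_norm_def using p by (intro epowr_mono) auto
  then show ?thesis using p by (simp add: epowr_epowr S_def)
qed

section \<open>A convexity inequality that survives integration\<close>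

text \<open>The inequality of the introduction, with the subtracted term moved to the left so that
  it makes sense for infinite norms. The intended arguments are the norms \<open>a\<close>, \<open>b\<close> of
  two vectors, \<open>m\<close> of their mean, and \<open>d\<close> of their difference.\<close>

definition convexity_ineq :: "real \<Rightarrow> real \<Rightarrow> real \<Rightarrow> ennreal \<Rightarrow> ennreal \<Rightarrow> ennreal \<Rightarrow> ennreal \<Rightarrow> bool" where
  "convexity_ineq p e C a b m d \<longleftrightarrow>
     epowr d p + ennreal C * epowr m p \<le> ennreal (e + C / 2) * (epowr a p + epowr b p)"

lemma convexity_ineq_Lp_norm:
  assumes p: "0 < p" and
    [measurable]: "a \<in> borel_measurable M" "b \<in> borel_measurable M" "m \<in> borel_measurable M" "d \<in> borel_measurable M"
    and ineq: "\<And>y. y \<in> space M \<Longrightarrow> convexity_ineq p e C (a y) (b y) (m y) (d y)"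
  shows "convexity_ineq p e C (Lp_norm M p a) (Lp_norm M p b) (Lp_norm M p m) (Lp_norm M p d)"
proof -
  have "(\<integral>\<^sup>+ y. epowr (d y) p + ennreal C * epowr (m y) p \<partial>M)
      \<le> (\<integral>\<^sup>+ y. ennreal (e + C / 2) * (epowr (a y) p + epowr (b y) p) \<partial>M)"
    using ineq by (intro nn_integral_mono) (simp add: convexity_ineq_def)
  then show ?thesis using p
    by (simp add: convexity_ineq_def epowr_Lp_norm nn_integral_add nn_integral_cmult)
qed

text \<open>The gap between the mean of \<open>a\<^sup>p\<close>, \<open>b\<^sup>p\<close> and \<open>m\<^sup>p\<close> being bounded away from
  zero does not depend on the exponent. On the compact set of normalized triples whose \<open>p\<close>-gap
  is at least \<open>c\<close>, the \<open>q\<close>-gap is continuous and positive: if \<open>a \<noteq> b\<close> by strict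
  convexity, and if \<open>a = b = 1\<close> because the \<open>p\<close>-gap forces \<open>m < 1\<close>.\<close>

lemma mean_gap_transfer:
  fixes p q c :: real
  assumes p: "0 < p" and q: "1 < q" and c: "0 < c"
  shows "\<exists>c'>0. \<forall>a b m. 0 \<le> a \<and> 0 \<le> b \<and> 0 \<le> m \<and> max a b = 1 \<and> 2 * m \<le> a + b \<and>
       c \<le> (a powr p + b powr p) / 2 - m powr p \<longrightarrow> c' \<le> (a powr q + b powr q) / 2 - m powr q"
proof -
  define gap :: "real \<Rightarrow> real \<times> real \<times> real \<Rightarrow> real"
    where "gap s z = (fst z powr s + fst (snd z) powr s) / 2 - snd (snd z) powr s" for s z
  define B :: "(real \<times> real \<times> real) set" where "B = {0..1} \<times> {0..1} \<times> {0..1}"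
  define K where "K = {z \<in> B. max (fst z) (fst (snd z)) = 1 \<and> 2 * snd (snd z) \<le> fst z + fst (snd z) \<and> c \<le> gap p z}"
  have cont: "continuous_on B (gap s)" if "0 < s" for s
    unfolding gap_def B_def using that
    by (intro continuous_intros continuous_on_powr') auto
  have "compact B" unfolding B_def by (intro compact_Times) auto
  have "closed B" using \<open>compact B\<close> by (rule compact_imp_closed)
  have "closed {z \<in> B. c \<le> gap p z}"
    using continuous_on_closed_Collect_le[OF continuous_on_const cont[OF p] \<open>closed B\<close>] .
  moreover have "closed {z :: real \<times> real \<times> real. max (fst z) (fst (snd z)) = 1 \<and> 2 * snd (snd z) \<le> fst z + fst (snd z)}"
    by (intro closed_Collect_conj closed_Collect_eq closed_Collect_le continuous_intros)
  ultimately have "closed ({z \<in> B. c \<le> gap p z} \<inter> {z. max (fst z) (fst (snd z)) = 1 \<and> 2 * snd (snd z) \<le> fst z + fst (snd z)})"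
    by (rule closed_Int)
  then have "compact (B \<inter> ({z \<in> B. c \<le> gap p z} \<inter> {z. max (fst z) (fst (snd z)) = 1 \<and> 2 * snd (snd z) \<le> fst z + fst (snd z)}))"
    by (rule compact_Int_closed[OF \<open>compact B\<close>])
  also have "\<dots> = K" by (auto simp: K_def)
  finally have "compact K" .
  have pos: "0 < gap q z" if "z \<in> K" for z
  proof -
    obtain a b m where z: "z = (a, b, m)" by (cases z) auto
    have *: "0 \<le> a" "0 \<le> b" "0 \<le> m" "max a b = 1" "2 * m \<le> a + b" "c \<le> (a powr p + b powr p) / 2 - m powr p"
      using that by (auto simp: K_def B_def z gap_def)
    show ?thesis
    proof (cases "a = b")
      case True
      then have ab: "a = 1" "b = 1" using * by auto
      have "m < 1"
      proof (rule ccontr)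
        assume "\<not> m < 1"
        then have "1 powr p \<le> m powr p" using p by (intro powr_mono2) auto
        then show False using * ab c by simp
      qed
      then have "m powr q < 1 powr q" using * q by (intro powr_less_mono2) auto
      then show ?thesis using ab by (simp add: z gap_def)
    next
      case False
      have "m powr q \<le> ((a + b) / 2) powr q" using * q by (intro powr_mono2) auto
      also have "\<dots> < (a powr q + b powr q) / 2" using * q False by (intro powr_mean_strict)
      finally show ?thesis by (simp add: z gap_def)
    qed
  qed
  have in_K: "(a, b, m) \<in> K" if "0 \<le> a" "0 \<le> b" "0 \<le> m" "max a b = 1" "2 * m \<le> a + b"
     "c \<le> (a powr p + b powr p) / 2 - m powr p" for a b m
    using that by (auto simp: K_def B_def gap_def)
  show ?thesis
  proof (cases "K = {}")
    case True
    then have "1 \<le> (a powr q + b powr q) / 2 - m powr q"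
      if "0 \<le> a \<and> 0 \<le> b \<and> 0 \<le> m \<and> max a b = 1 \<and> 2 * m \<le> a + b \<and>
        c \<le> (a powr p + b powr p) / 2 - m powr p" for a b m
      using in_K[of a b m] that by simp
    then show ?thesis by (intro exI[of _ 1] conjI allI impI zero_less_one)
  next
    case False
    have "continuous_on K (gap q)"
      by (rule continuous_on_subset[OF cont]) (use q in \<open>auto simp: K_def\<close>)
    from continuous_attains_inf[OF \<open>compact K\<close> False this]
    obtain z where z: "z \<in> K" "\<And>w. w \<in> K \<Longrightarrow> gap q z \<le> gap q w" by blast
    then have "gap q z \<le> (a powr q + b powr q) / 2 - m powr q"
      if "0 \<le> a \<and> 0 \<le> b \<and> 0 \<le> m \<and> max a b = 1 \<and> 2 * m \<le> a + b \<and>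
        c \<le> (a powr p + b powr p) / 2 - m powr p" for a b m
      using z(2)[OF in_K[of a b m]] that by (simp add: gap_def)
    then show ?thesis using pos[OF z(1)] by (intro exI[of _ "gap q z"] conjI allI impI)
  qed
qed

definition power_convex :: "real \<Rightarrow> (ennreal \<times> ennreal \<times> ennreal \<times> ennreal) set \<Rightarrow> bool" where
  "power_convex p S \<longleftrightarrow> (\<forall>e>0. \<exists>C>0. \<forall>(a, b, m, d)\<in>S. convexity_ineq p e C a b m d)"

lemma convexity_ineq_real:
  assumes "0 \<le> a" "0 \<le> b" "0 \<le> m" "0 \<le> d" "0 < e" "0 < C"
  shows "convexity_ineq p e C (ennreal a) (ennreal b) (ennreal m) (ennreal d) \<longleftrightarrow>
    d powr p + C * m powr p \<le> (e + C / 2) * (a powr p + b powr p)"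
proof -
  have "convexity_ineq p e C (ennreal a) (ennreal b) (ennreal m) (ennreal d) \<longleftrightarrow>
    ennreal (d powr p + C * m powr p) \<le> ennreal ((e + C / 2) * (a powr p + b powr p))"
    using assms by (simp add: convexity_ineq_def epowr_ennreal ennreal_mult ennreal_plus)
  also have "\<dots> \<longleftrightarrow> d powr p + C * m powr p \<le> (e + C / 2) * (a powr p + b powr p)"
    using assms by (intro ennreal_le_iff) auto
  finally show ?thesis .
qed

text \<open>By homogeneity one may take \<open>max a b = 1\<close>. Either \<open>d\<^sup>q \<le> e\<close>, and then the \<open>e\<close>-term
  alone dominates \<open>d\<^sup>q\<close>. Or \<open>d\<close> is bounded below, so the inequality for \<open>p\<close> yields a
  lower bound for the \<open>p\<close>-gap, hence for the \<open>q\<close>-gap, and a large constant lets the gap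
  absorb \<open>d\<^sup>q \<le> 2\<^sup>q\<close>.\<close>

lemma power_convex_change_exponent:
  assumes p: "0 < p" and q: "1 < q"
    and S: "\<And>a b m d. (a, b, m, d) \<in> S \<Longrightarrow> 2 * m \<le> a + b \<and> d \<le> a + b"
    and conv: "power_convex p S"
  shows "power_convex q S"
  unfolding power_convex_def
proof (intro allI impI)
  fix e :: real assume e: "0 < e"
  define \<eta> where "\<eta> = (e powr (1 / q)) powr p"
  have \<eta>: "0 < \<eta>" using e by (simp add: \<eta>_def)
  then have "0 < \<eta> / 4" by simp
  with conv obtain C where C: "0 < C"
    and "\<forall>(a, b, m, d)\<in>S. convexity_ineq p (\<eta> / 4) C a b m d"
    unfolding power_convex_def by blast
  then have ineq: "convexity_ineq p (\<eta> / 4) C a b m d" if "(a, b, m, d) \<in> S" for a b m d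
    using that by fast
  \<comment> \<open>If \<open>\<eta> \<le> d\<^sup>p\<close>, the term with factor \<open>\<eta> / 4\<close> accounts for at most \<open>\<eta> / 2\<close>,
    so that \<open>C\<close> times the gap is at least \<open>\<eta> / 2\<close>.\<close>
  have "0 < \<eta> / (2 * C)" using \<eta> C by simp
  from mean_gap_transfer[OF p q this] obtain c where
    gap: "0 < c \<and> (\<forall>a b m. 0 \<le> a \<and> 0 \<le> b \<and> 0 \<le> m \<and> max a b = 1 \<and> 2 * m \<le> a + b \<and>
      \<eta> / (2 * C) \<le> (a powr p + b powr p) / 2 - m powr p \<longrightarrow> c \<le> (a powr q + b powr q) / 2 - m powr q)" ..
  then have c: "0 < c" ..
  \<comment> \<open>With \<open>d \<le> a + b \<le> 2\<close> and gap at least \<open>c\<close>, this constant gives \<open>d\<^sup>q \<le> D c\<close>.\<close>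
  define D where "D = 2 powr q / c"
  have D: "0 < D" using c by (simp add: D_def)
  have normalized: "d powr q + D * m powr q \<le> (e + D / 2) * (a powr q + b powr q)"
    if *: "0 \<le> a" "0 \<le> b" "0 \<le> m" "0 \<le> d" "max a b = 1" "2 * m \<le> a + b" "d \<le> a + b"
      and i: "d powr p + C * m powr p \<le> (\<eta> / 4 + C / 2) * (a powr p + b powr p)" for a b m d :: real
  proof (cases "d powr q \<le> e")
    case True
    have "1 \<le> a powr q + b powr q" using * by (auto simp: max_def split: if_splits)
    then have "e * 1 \<le> e * (a powr q + b powr q)" using e by (intro mult_left_mono) auto
    then have "d powr q \<le> e * (a powr q + b powr q)" using True by linarith
    moreover have "m powr q \<le> (1/2 * a + 1/2 * b) powr q" using * q by (intro powr_mono2) auto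
    moreover have "\<dots> \<le> 1/2 * a powr q + 1/2 * b powr q" using * q by (intro powr_convex_combination) auto
    ultimately have "d powr q + D * m powr q \<le> e * (a powr q + b powr q) + D * (1/2 * a powr q + 1/2 * b powr q)"
      using D by (intro add_mono mult_left_mono) auto
    then show ?thesis by (simp add: algebra_simps)
  next
    case False
    then have "e powr (1 / q) \<le> (d powr q) powr (1 / q)" using e q by (intro powr_mono2) auto
    then have "e powr (1 / q) \<le> d" using * q by (simp add: powr_powr)
    then have d: "\<eta> \<le> d powr p" unfolding \<eta>_def using p by (intro powr_mono2) auto
    have "a powr p + b powr p \<le> 1 + 1" using * p by (intro add_mono powr_le1) auto
    then have "\<eta> / 4 * (a powr p + b powr p) \<le> \<eta> / 4 * 2" using \<eta> by (intro mult_left_mono) auto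
    then have "\<eta> / 2 \<le> C * ((a powr p + b powr p) / 2 - m powr p)" using i d by (simp add: algebra_simps)
    then have "\<eta> / (2 * C) \<le> (a powr p + b powr p) / 2 - m powr p" using C by (simp add: field_simps)
    then have g: "c \<le> (a powr q + b powr q) / 2 - m powr q" using * gap by simp
    have "d powr q \<le> 2 powr q" using * q by (intro powr_mono2) auto
    also have "\<dots> = D * c" using c by (simp add: D_def)
    also have "\<dots> \<le> D * ((a powr q + b powr q) / 2 - m powr q)" using g D by (intro mult_left_mono) auto
    finally have "d powr q + D * m powr q \<le> D / 2 * (a powr q + b powr q)" by (simp add: algebra_simps)
    also have "\<dots> \<le> (e + D / 2) * (a powr q + b powr q)" using e by (intro mult_right_mono) auto
    finally show ?thesis .
  qed
  have "convexity_ineq q e D a b m d" if abmd: "(a, b, m, d) \<in> S" for a b m d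
  proof (cases "a = \<infinity> \<or> b = \<infinity>")
    case True
    then show ?thesis using e D by (auto simp: convexity_ineq_def ennreal_mult_top)
  next
    case False
    then obtain a' b' where ab: "a = ennreal a'" "b = ennreal b'" "0 \<le> a'" "0 \<le> b'" by (cases a; cases b) auto
    have md: "2 * m \<le> ennreal (a' + b')" "d \<le> ennreal (a' + b')" using S[OF abmd] ab by (simp_all add: ennreal_plus)
    have "m < \<infinity>" using md(1) by (cases "m = \<infinity>") (auto simp: ennreal_mult_top top_unique less_top)
    moreover have "d < \<infinity>" using md(2) by (cases "d = \<infinity>") (auto simp: top_unique less_top)
    ultimately obtain m' d' where md': "m = ennreal m'" "d = ennreal d'" "0 \<le> m'" "0 \<le> d'"
      by (cases m; cases d) auto
    have "ennreal (2 * m') \<le> ennreal (a' + b')" using md(1) md' by (simp add: ennreal_mult)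
    then have m2: "2 * m' \<le> a' + b'" using ab by (subst (asm) ennreal_le_iff) auto
    have d2: "d' \<le> a' + b'" using md(2) ab unfolding md'(2) by (subst (asm) ennreal_le_iff) auto
    have i: "d' powr p + C * m' powr p \<le> (\<eta> / 4 + C / 2) * (a' powr p + b' powr p)"
      using ineq[OF abmd] ab md' \<eta> C by (simp add: convexity_ineq_real)
    have "d' powr q + D * m' powr q \<le> (e + D / 2) * (a' powr q + b' powr q)"
    proof (cases "max a' b' = 0")
      case True
      then have "a' = 0" "b' = 0" "m' = 0" "d' = 0" using ab md' m2 d2 by auto
      then show ?thesis by simp
    next
      case False
      define s where "s = max a' b'"
      have s: "0 < s" using False ab by (auto simp: s_def)
      have scale: "(x / s) powr k = x powr k / s powr k" if "0 \<le> x" for x k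
        using that s by (simp add: powr_divide)
      have distr: "(x + z * y) / w = x / w + z * (y / w)" "z * (x + y) / w = z * (x / w + y / w)" for x y z w :: real
        by (simp_all add: add_divide_distrib distrib_left)
      have "(d' powr p + C * m' powr p) / s powr p \<le> ((\<eta> / 4 + C / 2) * (a' powr p + b' powr p)) / s powr p"
        by (intro divide_right_mono i) auto
      then have "(d' / s) powr p + C * (m' / s) powr p \<le> (\<eta> / 4 + C / 2) * ((a' / s) powr p + (b' / s) powr p)"
        using ab(3,4) md'(3,4) by (simp only: distr scale)
      moreover have "max (a' / s) (b' / s) = 1" using s max_divide_distrib_right[of a' b' s] by (simp add: s_def)
      moreover have "2 * (m' / s) \<le> a' / s + b' / s" using m2 s by (simp add: field_simps)
      moreover have "d' / s \<le> a' / s + b' / s" using d2 s by (simp add: field_simps)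
      ultimately have "(d' / s) powr q + D * (m' / s) powr q \<le> (e + D / 2) * ((a' / s) powr q + (b' / s) powr q)"
        using ab md' s by (intro normalized) auto
      then have "(d' powr q + D * m' powr q) / s powr q \<le> ((e + D / 2) * (a' powr q + b' powr q)) / s powr q"
        using ab(3,4) md'(3,4) by (simp only: distr scale)
      then show ?thesis using s by (simp add: divide_le_cancel)
    qed
    then show ?thesis using ab md' e D by (simp add: convexity_ineq_real)
  qed
  then show "\<exists>C>0. \<forall>(a, b, m, d)\<in>S. convexity_ineq q e C a b m d" using D by (intro exI[of _ D]) auto
qed

text \<open>The parallelogram law is the case \<open>q = 2\<close> with \<open>C = 4\<close>, whatever \<open>e\<close> is.\<close>

lemma power_convex_scalar:
  assumes q: "1 < q"
  shows "power_convex q {(ennreal (cmod z), ennreal (cmod w), ennreal (cmod ((z + w) / 2)), ennreal (cmod (z - w))) | z w. True}"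
    (is "power_convex q ?S")
proof (rule power_convex_change_exponent[where p = 2])
  show "2 * m \<le> a + b \<and> d \<le> a + b" if "(a, b, m, d) \<in> ?S" for a b m d
  proof -
    obtain z w where zw: "a = ennreal (cmod z)" "b = ennreal (cmod w)" "m = ennreal (cmod ((z + w) / 2))"
       "d = ennreal (cmod (z - w))" using \<open>(a, b, m, d) \<in> ?S\<close> by blast
    have "2 * m = ennreal (2 * cmod ((z + w) / 2))" unfolding zw by (subst ennreal_mult) auto
    also have "2 * cmod ((z + w) / 2) = cmod (z + w)" by (simp add: norm_divide)
    finally show ?thesis
      by (simp add: zw norm_triangle_ineq norm_triangle_ineq4 ennreal_leI flip: ennreal_plus)
  qed
  show "power_convex 2 ?S"
    unfolding power_convex_def
  proof (intro allI impI exI[of _ "4 :: real"] conjI)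
    fix e :: real assume e: "0 < e"
    have "convexity_ineq 2 e 4 (ennreal (cmod z)) (ennreal (cmod w)) (ennreal (cmod ((z + w) / 2))) (ennreal (cmod (z - w)))" for z w
    proof -
      have "(cmod (z - w))\<^sup>2 + 4 * (cmod ((z + w) / 2))\<^sup>2 = 2 * ((cmod z)\<^sup>2 + (cmod w)\<^sup>2)"
        unfolding norm_divide power_divide cmod_power2 by (simp add: power2_eq_square algebra_simps)
      also have "\<dots> \<le> (e + 4 / 2) * ((cmod z)\<^sup>2 + (cmod w)\<^sup>2)" using e by (intro mult_right_mono) auto
      finally show ?thesis using e by (subst convexity_ineq_real) (auto simp: powr_numeral)
    qed
    then show "\<forall>(a, b, m, d)\<in>?S. convexity_ineq 2 e 4 a b m d" by blast
  qed auto
qed (use q in auto)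

section \<open>Complex normed spaces and their duals\<close>

lemma complex_field_simps [simp]:
  "carrier complex_field = UNIV" "mult complex_field = (*)" "one complex_field = 1"
  "zero complex_field = 0" "add complex_field = (+)"
  by (simp_all add: complex_field_def)

lemma cring_complex_field: "cring complex_field"
proof (rule cringI)
  show "abelian_group complex_field"
    by (rule abelian_groupI) (auto intro: exI[of _ "- x" for x])
  show "comm_monoid complex_field"
    by (rule comm_monoidI) auto
qed (auto simp: algebra_simps)

lemma a_inv_complex_field [simp]: "\<ominus>\<^bsub>complex_field\<^esub> z = - z"
proof -
  interpret cring complex_field by (rule cring_complex_field)
  show ?thesis using minus_equality[of "- z" z] by simp
qed

locale complex_normed =
  fixes X :: "('a, 'm) normed_module_scheme" (structure)
  assumes cns: "complex_normed_space X"

sublocale complex_normed \<subseteq> module complex_field X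
  using cns by (simp add: complex_normed_space_def)

context complex_normed
begin

lemma norm_nonneg: "x \<in> carrier X \<Longrightarrow> 0 \<le> vnorm X x"
  and norm_eq_0: "x \<in> carrier X \<Longrightarrow> vnorm X x = 0 \<longleftrightarrow> x = \<zero>\<^bsub>X\<^esub>"
  and norm_smult: "x \<in> carrier X \<Longrightarrow> vnorm X (c \<odot>\<^bsub>X\<^esub> x) = cmod c * vnorm X x"
  using cns by (simp_all add: complex_normed_space_def)

lemma smult_in: "x \<in> carrier X \<Longrightarrow> c \<odot>\<^bsub>X\<^esub> x \<in> carrier X"
  using smult_closed[of c x] by simp

lemma minus_eq_smult: "x \<in> carrier X \<Longrightarrow> \<ominus>\<^bsub>X\<^esub> x = (-1) \<odot>\<^bsub>X\<^esub> x"
  using smult_l_minus[of 1 x] smult_one[of x] by simp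

lemma diff_eq_smult: "y \<in> carrier X \<Longrightarrow> x \<ominus>\<^bsub>X\<^esub> y = x \<oplus>\<^bsub>X\<^esub> ((-1) \<odot>\<^bsub>X\<^esub> y)"
  by (simp add: a_minus_def minus_eq_smult)

abbreviation dual_norm :: "('a \<Rightarrow> complex) \<Rightarrow> real" where
  "dual_norm \<equiv> vnorm (dual_space X)"

lemma functional_add:
  "\<phi> \<in> bounded_functionals X \<Longrightarrow> x \<in> carrier X \<Longrightarrow> y \<in> carrier X \<Longrightarrow> \<phi> (x \<oplus>\<^bsub>X\<^esub> y) = \<phi> x + \<phi> y"
  and functional_smult:
  "\<phi> \<in> bounded_functionals X \<Longrightarrow> x \<in> carrier X \<Longrightarrow> \<phi> (c \<odot>\<^bsub>X\<^esub> x) = c * \<phi> x"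
  by (simp_all add: bounded_functionals_def)

lemma functional_diff:
  "\<phi> \<in> bounded_functionals X \<Longrightarrow> x \<in> carrier X \<Longrightarrow> y \<in> carrier X \<Longrightarrow> \<phi> (x \<ominus>\<^bsub>X\<^esub> y) = \<phi> x - \<phi> y"
  by (simp add: diff_eq_smult functional_add functional_smult smult_in)

lemma bdd_above_functional:
  assumes "\<phi> \<in> bounded_functionals X"
  shows "bdd_above ((\<lambda>x. cmod (\<phi> x)) ` {x \<in> carrier X. vnorm X x \<le> 1})"
proof -
  obtain B where B: "\<forall>x\<in>carrier X. cmod (\<phi> x) \<le> B * vnorm X x"
    using assms by (auto simp: bounded_functionals_def)
  have "cmod (\<phi> x) \<le> \<bar>B\<bar>" if "x \<in> carrier X" "vnorm X x \<le> 1" for x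
  proof -
    have "cmod (\<phi> x) \<le> B * vnorm X x" using B that by blast
    also have "\<dots> \<le> \<bar>B\<bar> * vnorm X x"
      using norm_nonneg[OF that(1)] by (intro mult_right_mono) auto
    also have "\<dots> \<le> \<bar>B\<bar> * 1" using that by (intro mult_left_mono) auto
    finally show ?thesis by simp
  qed
  then show ?thesis by (auto intro!: bdd_aboveI)
qed

lemma unit_ball_nonempty: "{x \<in> carrier X. vnorm X x \<le> 1} \<noteq> {}"
  using norm_eq_0[of "\<zero>\<^bsub>X\<^esub>"] by (auto intro!: exI[of _ "\<zero>\<^bsub>X\<^esub>"])

lemma dual_norm_upper:
  "\<phi> \<in> bounded_functionals X \<Longrightarrow> x \<in> carrier X \<Longrightarrow> vnorm X x \<le> 1 \<Longrightarrow> cmod (\<phi> x) \<le> dual_norm \<phi>"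
  unfolding dual_space_def by (auto intro!: cSUP_upper bdd_above_functional)

lemma dual_norm_least:
  "(\<And>x. x \<in> carrier X \<Longrightarrow> vnorm X x \<le> 1 \<Longrightarrow> cmod (\<phi> x) \<le> B) \<Longrightarrow> dual_norm \<phi> \<le> B"
  unfolding dual_space_def using unit_ball_nonempty by (auto intro!: cSUP_least)

lemma dual_norm_nonneg:
  assumes "\<phi> \<in> bounded_functionals X" shows "0 \<le> dual_norm \<phi>"
proof -
  have "cmod (\<phi> \<zero>\<^bsub>X\<^esub>) \<le> dual_norm \<phi>"
    using norm_eq_0[of "\<zero>\<^bsub>X\<^esub>"] by (intro dual_norm_upper assms) auto
  then show ?thesis by (rule order_trans[OF norm_ge_zero])
qed

lemma functional_bound:
  assumes \<phi>: "\<phi> \<in> bounded_functionals X" and x: "x \<in> carrier X"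
  shows "cmod (\<phi> x) \<le> dual_norm \<phi> * vnorm X x"
proof (cases "vnorm X x = 0")
  case True
  obtain B where "cmod (\<phi> x) \<le> B * vnorm X x"
    using \<phi> x by (auto simp: bounded_functionals_def)
  with True show ?thesis by simp
next
  case False
  then have pos: "vnorm X x > 0" using norm_nonneg[OF x] by simp
  let ?y = "complex_of_real (1 / vnorm X x) \<odot>\<^bsub>X\<^esub> x"
  have "cmod (\<phi> ?y) \<le> dual_norm \<phi>"
    using x pos by (intro dual_norm_upper \<phi>) (auto simp: norm_smult smult_in norm_divide)
  also have "cmod (\<phi> ?y) = cmod (\<phi> x) / vnorm X x"
    using pos by (simp add: functional_smult[OF \<phi> x] norm_mult norm_divide)
  finally show ?thesis using pos by (simp add: field_simps)
qed

text \<open>Multiplying by a unimodular scalar turns \<open>cmod (\<phi> x)\<close> into a real part.\<close>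

lemma nearly_norming:
  assumes \<phi>: "\<phi> \<in> bounded_functionals X" and c: "c < dual_norm \<phi>"
  obtains x where "x \<in> carrier X" "vnorm X x \<le> 1" "c < Re (\<phi> x)"
proof -
  obtain x where x: "x \<in> carrier X" "vnorm X x \<le> 1" "c < cmod (\<phi> x)"
    using c dual_norm_least[of \<phi> c] by (meson not_less)
  show ?thesis
  proof (cases "\<phi> x = 0")
    case True with that[of x] x show ?thesis by simp
  next
    case False
    define u where "u = cnj (\<phi> x) / of_real (cmod (\<phi> x))"
    have u: "cmod u = 1" "u * \<phi> x = of_real (cmod (\<phi> x))"
      using False by (auto simp: u_def norm_divide complex_norm_square[symmetric] power2_eq_square field_simps)
    show ?thesis
      using x u by (intro that[of "u \<odot>\<^bsub>X\<^esub> x"]) (auto simp: norm_smult smult_in functional_smult[OF \<phi>])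
  qed
qed

lemma bounded_functionalsI:
  assumes "\<phi> \<in> extensional (carrier X)"
    "\<And>x y. x \<in> carrier X \<Longrightarrow> y \<in> carrier X \<Longrightarrow> \<phi> (x \<oplus>\<^bsub>X\<^esub> y) = \<phi> x + \<phi> y"
    "\<And>c x. x \<in> carrier X \<Longrightarrow> \<phi> (c \<odot>\<^bsub>X\<^esub> x) = c * \<phi> x"
    "\<And>x. x \<in> carrier X \<Longrightarrow> cmod (\<phi> x) \<le> B * vnorm X x"
  shows "\<phi> \<in> bounded_functionals X"
  using assms unfolding bounded_functionals_def by blast

lemma functional_zero_closed: "(\<lambda>x\<in>carrier X. 0) \<in> bounded_functionals X"
  by (rule bounded_functionalsI[where B = 0]) (auto simp: smult_in)

lemma functional_add_closed:
  assumes "\<phi> \<in> bounded_functionals X" "\<psi> \<in> bounded_functionals X"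
  shows "(\<lambda>x\<in>carrier X. \<phi> x + \<psi> x) \<in> bounded_functionals X"
proof (rule bounded_functionalsI[where B = "dual_norm \<phi> + dual_norm \<psi>"])
  fix x assume x: "x \<in> carrier X"
  show "cmod ((\<lambda>x\<in>carrier X. \<phi> x + \<psi> x) x) \<le> (dual_norm \<phi> + dual_norm \<psi>) * vnorm X x"
    using functional_bound[OF assms(1) x] functional_bound[OF assms(2) x] x
      norm_triangle_ineq[of "\<phi> x" "\<psi> x"] by (simp add: algebra_simps)
qed (auto simp: functional_add functional_smult assms smult_in algebra_simps)

lemma functional_smult_closed:
  assumes "\<phi> \<in> bounded_functionals X"
  shows "(\<lambda>x\<in>carrier X. c * \<phi> x) \<in> bounded_functionals X"
proof (rule bounded_functionalsI[where B = "cmod c * dual_norm \<phi>"])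
  fix x assume x: "x \<in> carrier X"
  show "cmod ((\<lambda>x\<in>carrier X. c * \<phi> x) x) \<le> (cmod c * dual_norm \<phi>) * vnorm X x"
    using functional_bound[OF assms(1) x] x by (simp add: norm_mult mult.assoc mult_left_mono)
qed (auto simp: functional_add functional_smult assms smult_in algebra_simps)

lemma dual_space_simps:
  "carrier (dual_space X) = bounded_functionals X"
  "zero (dual_space X) = (\<lambda>x\<in>carrier X. 0)"
  "add (dual_space X) \<phi> \<psi> = (\<lambda>x\<in>carrier X. \<phi> x + \<psi> x)"
  "smult (dual_space X) c \<phi> = (\<lambda>x\<in>carrier X. c * \<phi> x)"
  by (simp_all add: dual_space_def)

lemma functional_ext:
  assumes "\<phi> \<in> bounded_functionals X" "\<psi> \<in> bounded_functionals X"
    "\<And>x. x \<in> carrier X \<Longrightarrow> \<phi> x = \<psi> x"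
  shows "\<phi> = \<psi>"
  using assms by (auto intro!: extensionalityI[of \<phi> "carrier X" \<psi>] simp: bounded_functionals_def)

lemma restrict_functional:
  "\<phi> \<in> bounded_functionals X \<Longrightarrow> restrict \<phi> (carrier X) = \<phi>"
  by (simp add: bounded_functionals_def extensional_restrict)

lemma dual_complex_normed: "complex_normed_space (dual_space X)"
  unfolding complex_normed_space_def
proof (intro conjI ballI allI)
  show "module complex_field (dual_space X)"
  proof (rule moduleI[OF cring_complex_field])
    show "abelian_group (dual_space X)"
    proof (rule abelian_groupI, unfold dual_space_simps)
      fix \<phi> assume \<phi>: "\<phi> \<in> bounded_functionals X"
      show "\<exists>\<psi>\<in>bounded_functionals X. (\<lambda>x\<in>carrier X. \<psi> x + \<phi> x) = (\<lambda>x\<in>carrier X. 0)"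
        by (rule bexI[OF _ functional_smult_closed[OF \<phi>, of "-1"]]) (auto intro!: restrict_ext)
      show "(\<lambda>x\<in>carrier X. (\<lambda>x\<in>carrier X. 0) x + \<phi> x) = \<phi>"
        by (intro functional_ext functional_add_closed functional_zero_closed \<phi>) simp
    qed (auto intro!: restrict_ext functional_add_closed functional_zero_closed simp: algebra_simps)
  qed (auto simp: dual_space_simps functional_smult_closed algebra_simps restrict_functional
          intro!: restrict_ext)
next
  fix \<phi> assume "\<phi> \<in> carrier (dual_space X)"
  then have \<phi>: "\<phi> \<in> bounded_functionals X" by (simp add: dual_space_simps)
  show "0 \<le> dual_norm \<phi>" by (rule dual_norm_nonneg[OF \<phi>])
  show "dual_norm \<phi> = 0 \<longleftrightarrow> \<phi> = \<zero>\<^bsub>dual_space X\<^esub>"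
  proof
    assume "dual_norm \<phi> = 0"
    then show "\<phi> = \<zero>\<^bsub>dual_space X\<^esub>"
      unfolding dual_space_simps using functional_bound[OF \<phi>]
      by (intro functional_ext \<phi> functional_zero_closed) auto
  next
    assume "\<phi> = \<zero>\<^bsub>dual_space X\<^esub>"
    then have "dual_norm \<phi> \<le> 0" by (intro dual_norm_least) (simp add: dual_space_simps)
    with dual_norm_nonneg[OF \<phi>] show "dual_norm \<phi> = 0" by simp
  qed
  fix c
  have le: "dual_norm (\<lambda>x\<in>carrier X. c * \<psi> x) \<le> cmod c * dual_norm \<psi>"
    if "\<psi> \<in> bounded_functionals X" for c \<psi>
    by (rule dual_norm_least) (auto simp: norm_mult intro!: mult_left_mono dual_norm_upper that)
  show "dual_norm (c \<odot>\<^bsub>dual_space X\<^esub> \<phi>) = cmod c * dual_norm \<phi>"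
  proof (cases "c = 0")
    case True
    have "dual_norm (\<lambda>x\<in>carrier X. c * \<phi> x) \<le> 0" using le[OF \<phi>, of c] True by simp
    with dual_norm_nonneg[OF functional_smult_closed[OF \<phi>, of c]] True show ?thesis
      by (simp add: dual_space_simps)
  next
    case False
    have "dual_norm \<phi> = dual_norm (\<lambda>x\<in>carrier X. (1 / c) * (\<lambda>x\<in>carrier X. c * \<phi> x) x)"
      using False by (intro arg_cong[where f = dual_norm] functional_ext \<phi> functional_smult_closed) auto
    also have "\<dots> \<le> cmod (1 / c) * dual_norm (\<lambda>x\<in>carrier X. c * \<phi> x)"
      by (intro le functional_smult_closed \<phi>)
    finally have "cmod c * dual_norm \<phi> \<le> dual_norm (\<lambda>x\<in>carrier X. c * \<phi> x)"
      using False by (simp add: norm_divide field_simps)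
    with le[OF \<phi>, of c] show ?thesis by (simp add: dual_space_simps)
  qed
next
  fix \<phi> \<psi> assume "\<phi> \<in> carrier (dual_space X)" "\<psi> \<in> carrier (dual_space X)"
  then have *: "\<phi> \<in> bounded_functionals X" "\<psi> \<in> bounded_functionals X" by (simp_all add: dual_space_simps)
  show "dual_norm (\<phi> \<oplus>\<^bsub>dual_space X\<^esub> \<psi>) \<le> dual_norm \<phi> + dual_norm \<psi>"
    unfolding dual_space_simps
  proof (rule dual_norm_least)
    fix x assume x: "x \<in> carrier X" "vnorm X x \<le> 1"
    show "cmod ((\<lambda>x\<in>carrier X. \<phi> x + \<psi> x) x) \<le> dual_norm \<phi> + dual_norm \<psi>"
      using x norm_triangle_ineq[of "\<phi> x" "\<psi> x"] dual_norm_upper[OF *(1) x] dual_norm_upper[OF *(2) x] by simp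
  qed
qed

lemma canonical_embedding_in_bidual:
  assumes x: "x \<in> carrier X"
  shows "canonical_embedding X x \<in> carrier (dual_space (dual_space X))"
proof -
  interpret D: complex_normed "dual_space X" by standard (rule dual_complex_normed)
  show ?thesis
    unfolding D.dual_space_simps canonical_embedding_def
  proof (rule D.bounded_functionalsI[where B = "vnorm X x"])
    fix \<phi> assume "\<phi> \<in> carrier (dual_space X)"
    then show "cmod ((\<lambda>\<phi>\<in>carrier (dual_space X). \<phi> x) \<phi>) \<le> vnorm X x * dual_norm \<phi>"
      using functional_bound[of \<phi> x] x by (simp add: dual_space_simps mult.commute)
  qed (use x in \<open>auto simp: dual_space_simps functional_add_closed functional_smult_closed\<close>)
qed

end

section \<open>The Milman-Pettis theorem\<close>

text \<open>Completeness is asked for sequences whose increments are bounded by \<open>(1/2)^k\<close>. Every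
  Cauchy sequence has such a subsequence, so this is the usual notion, in the form that both the
  Riesz-Fischer argument and the argument below use.\<close>

locale uniformly_convex = complex_normed +
  assumes unif_convex: "\<And>e. e > 0 \<Longrightarrow> \<exists>d>0. \<forall>x\<in>carrier X. \<forall>y\<in>carrier X. vnorm X x \<le> 1 \<longrightarrow>
      vnorm X y \<le> 1 \<longrightarrow> 2 - d \<le> vnorm X (x \<oplus>\<^bsub>X\<^esub> y) \<longrightarrow> vnorm X (x \<ominus>\<^bsub>X\<^esub> y) \<le> e"
    and complete: "\<And>s. (\<And>k. s k \<in> carrier X) \<Longrightarrow>
      (\<And>k. vnorm X (s (Suc k) \<ominus>\<^bsub>X\<^esub> s k) \<le> (1/2)^k) \<Longrightarrow>
      \<exists>x\<in>carrier X. (\<lambda>k. vnorm X (s k \<ominus>\<^bsub>X\<^esub> x)) \<longlonglongrightarrow> 0"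
begin

text \<open>Two vectors of the unit ball at which one functional of norm at most one is nearly
  \<open>1\<close> have a sum of norm nearly \<open>2\<close>, hence are close together. One decreasing sequence
  \<open>e\<close> controls all accuracies \<open>(1/2)^k\<close> at once.\<close>

lemma modulus_sequence:
  obtains e :: "nat \<Rightarrow> real" where "\<And>k. 0 < e k" "decseq e" "e \<longlonglongrightarrow> 0"
    "\<And>k x y \<phi>. \<lbrakk>x \<in> carrier X; y \<in> carrier X; vnorm X x \<le> 1; vnorm X y \<le> 1;
       \<phi> \<in> bounded_functionals X; dual_norm \<phi> \<le> 1; 1 - 2 * e k \<le> Re (\<phi> x); 1 - 2 * e k \<le> Re (\<phi> y)\<rbrakk>
       \<Longrightarrow> vnorm X (x \<ominus>\<^bsub>X\<^esub> y) \<le> (1/2)^k"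
proof -
  have "\<forall>k. \<exists>d>0. \<forall>x\<in>carrier X. \<forall>y\<in>carrier X. vnorm X x \<le> 1 \<longrightarrow>
      vnorm X y \<le> 1 \<longrightarrow> 2 - d \<le> vnorm X (x \<oplus>\<^bsub>X\<^esub> y) \<longrightarrow> vnorm X (x \<ominus>\<^bsub>X\<^esub> y) \<le> (1/2)^k"
    by (intro allI unif_convex) simp
  then obtain d :: "nat \<Rightarrow> real" where d: "\<And>k. d k > 0"
    "\<And>k x y. \<lbrakk>x\<in>carrier X; y\<in>carrier X; vnorm X x \<le> 1; vnorm X y \<le> 1; 2 - d k \<le> vnorm X (x \<oplus>\<^bsub>X\<^esub> y)\<rbrakk>
       \<Longrightarrow> vnorm X (x \<ominus>\<^bsub>X\<^esub> y) \<le> (1/2)^k" by metis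
  define e where "e k = Min (insert ((1/2)^k) (d ` {..k})) / 4" for k
  have pos: "0 < e k" for k using d(1) by (auto simp: e_def)
  have le_d: "4 * e k \<le> d k" and le_p: "e k \<le> (1/2)^k" for k
  proof -
    have "Min (insert ((1/2)^k) (d ` {..k})) \<le> d k" by (rule Min_le) auto
    then show "4 * e k \<le> d k" unfolding e_def by simp
    have "4 * e k = Min (insert ((1/2)^k) (d ` {..k}))" by (simp add: e_def)
    also have "\<dots> \<le> (1/2)^k" by (rule Min_le) auto
    finally show "e k \<le> (1/2)^k" using pos[of k] by linarith
  qed
  have "decseq e"
  proof (rule decseq_SucI)
    fix k
    have "Min (insert ((1/2)^Suc k) (d ` {..Suc k})) \<le> x" if "x \<in> insert ((1/2)^k) (d ` {..k})" for x
    proof (cases "x = (1/2)^k")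
      case True
      have "Min (insert ((1/2)^Suc k) (d ` {..Suc k})) \<le> (1/2)^Suc k" by (rule Min_le) auto
      also have "\<dots> \<le> (1/2)^k" by simp
      finally show ?thesis using True by simp
    next
      case False then show ?thesis using that by (intro Min_le) auto
    qed
    then show "e (Suc k) \<le> e k" unfolding e_def by (intro divide_right_mono Min.boundedI) auto
  qed
  moreover have "e \<longlonglongrightarrow> 0"
  proof (rule tendsto_sandwich[of "\<lambda>_. 0" e sequentially "\<lambda>k. (1/2)^k"])
    show "(\<lambda>k. (1/2::real)^k) \<longlonglongrightarrow> 0" by (intro LIMSEQ_power_zero) simp
  qed (use pos le_p in \<open>auto intro!: always_eventually less_imp_le\<close>)
  moreover have "vnorm X (x \<ominus>\<^bsub>X\<^esub> y) \<le> (1/2)^k"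
    if *: "x \<in> carrier X" "y \<in> carrier X" "vnorm X x \<le> 1" "vnorm X y \<le> 1"
       and \<phi>: "\<phi> \<in> bounded_functionals X" "dual_norm \<phi> \<le> 1"
       and b: "1 - 2 * e k \<le> Re (\<phi> x)" "1 - 2 * e k \<le> Re (\<phi> y)" for k x y \<phi>
  proof (rule d(2)[OF *])
    have "2 - d k \<le> 2 - 4 * e k" using le_d[of k] by simp
    also have "\<dots> \<le> Re (\<phi> (x \<oplus>\<^bsub>X\<^esub> y))" using b by (simp add: functional_add[OF \<phi>(1) *(1,2)])
    also have "\<dots> \<le> cmod (\<phi> (x \<oplus>\<^bsub>X\<^esub> y))" by (rule complex_Re_le_cmod)
    also have "\<dots> \<le> dual_norm \<phi> * vnorm X (x \<oplus>\<^bsub>X\<^esub> y)" by (intro functional_bound \<phi>) (use * in auto)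
    also have "\<dots> \<le> 1 * vnorm X (x \<oplus>\<^bsub>X\<^esub> y)" by (intro mult_right_mono \<phi> norm_nonneg) (use * in auto)
    finally show "2 - d k \<le> vnorm X (x \<oplus>\<^bsub>X\<^esub> y)" by simp
  qed
  ultimately show thesis using pos by (intro that[of e]) auto
qed

text \<open>Choose \<open>\<phi>\<^sub>k\<close> in the dual unit ball with \<open>Re (F \<phi>\<^sub>k) > 1 - e\<^sub>k\<close>. A vector that nearly
  norms \<open>\<phi>\<^sub>k + \<phi>\<^sub>k\<^sub>+\<^sub>1\<close> nearly norms both, so consecutive choices \<open>s\<^sub>k\<close> are compared through their
  common functional and the sequence converges to some \<open>x\<close>. For any \<open>\<psi>\<close>, a vector \<open>y\<close> that
  nearly norms \<open>\<phi>\<^sub>k + t \<psi>\<close> for small \<open>t\<close> still nearly norms \<open>\<phi>\<^sub>k\<close>, hence is close to \<open>s\<^sub>k\<close>,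
  and at the same time \<open>Re (\<psi> y)\<close> is at least \<open>Re (F \<psi>)\<close> up to an error.\<close>

lemma bidual_unit_represented:
  assumes F: "F \<in> bounded_functionals (dual_space X)" and F1: "vnorm (dual_space (dual_space X)) F = 1"
  obtains x where "x \<in> carrier X" "\<And>\<phi>. \<phi> \<in> bounded_functionals X \<Longrightarrow> F \<phi> = \<phi> x"
proof -
  interpret D: complex_normed "dual_space X" by standard (rule dual_complex_normed)
  have F_le: "Re (F \<phi>) \<le> dual_norm \<phi>" if "\<phi> \<in> bounded_functionals X" for \<phi>
    using D.functional_bound[OF F, of \<phi>] that complex_Re_le_cmod[of "F \<phi>"]
    by (simp add: F1 dual_space_simps(1))
  have F_add: "F (\<lambda>x\<in>carrier X. \<phi> x + \<psi> x) = F \<phi> + F \<psi>"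
    if "\<phi> \<in> bounded_functionals X" "\<psi> \<in> bounded_functionals X" for \<phi> \<psi>
    using D.functional_add[OF F, of \<phi> \<psi>] that by (simp add: dual_space_simps)
  have F_smult: "F (\<lambda>x\<in>carrier X. c * \<phi> x) = c * F \<phi>" if "\<phi> \<in> bounded_functionals X" for c \<phi>
    using D.functional_smult[OF F, of \<phi> c] that by (simp add: dual_space_simps)
  obtain e :: "nat \<Rightarrow> real" where e: "\<And>k. 0 < e k" "decseq e" "e \<longlonglongrightarrow> 0"
    and close: "\<And>k x y \<phi>. \<lbrakk>x \<in> carrier X; y \<in> carrier X; vnorm X x \<le> 1; vnorm X y \<le> 1;
       \<phi> \<in> bounded_functionals X; dual_norm \<phi> \<le> 1; 1 - 2 * e k \<le> Re (\<phi> x); 1 - 2 * e k \<le> Re (\<phi> y)\<rbrakk>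
       \<Longrightarrow> vnorm X (x \<ominus>\<^bsub>X\<^esub> y) \<le> (1/2)^k"
    by (rule modulus_sequence) blast
  have "\<exists>\<phi>. \<phi> \<in> bounded_functionals X \<and> dual_norm \<phi> \<le> 1 \<and> 1 - e k < Re (F \<phi>)" for k
    using D.nearly_norming[OF F, of "1 - e k"] e(1)[of k] F1 by (auto simp: dual_space_simps(1))
  then obtain \<phi> where \<phi>: "\<And>k. \<phi> k \<in> bounded_functionals X" "\<And>k. dual_norm (\<phi> k) \<le> 1"
    "\<And>k. 1 - e k < Re (F (\<phi> k))" by metis
  have \<phi>_le: "Re (\<phi> k x) \<le> 1" if "x \<in> carrier X" "vnorm X x \<le> 1" for k x
    using dual_norm_upper[OF \<phi>(1) that, of k] \<phi>(2)[of k] complex_Re_le_cmod[of "\<phi> k x"] by simp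
  have "\<exists>x. x \<in> carrier X \<and> vnorm X x \<le> 1 \<and> 1 - 2 * e k \<le> Re (\<phi> k x) \<and> 1 - 2 * e k \<le> Re (\<phi> (Suc k) x)" for k
  proof -
    let ?\<psi> = "\<lambda>x\<in>carrier X. \<phi> k x + \<phi> (Suc k) x"
    have \<psi>: "?\<psi> \<in> bounded_functionals X" by (intro functional_add_closed \<phi>)
    have "2 - 2 * e k < Re (F ?\<psi>)"
      using \<phi>(3)[of k] \<phi>(3)[of "Suc k"] decseqD[OF e(2), of k "Suc k"] by (simp add: F_add \<phi>(1))
    also have "\<dots> \<le> dual_norm ?\<psi>" by (rule F_le[OF \<psi>])
    finally obtain x where x: "x \<in> carrier X" "vnorm X x \<le> 1" "2 - 2 * e k < Re (?\<psi> x)"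
      by (rule nearly_norming[OF \<psi>])
    then show ?thesis using \<phi>_le[OF x(1,2), of k] \<phi>_le[OF x(1,2), of "Suc k"]
      by (intro exI[of _ x]) auto
  qed
  then obtain s where s: "\<And>k. s k \<in> carrier X" "\<And>k. vnorm X (s k) \<le> 1"
    "\<And>k. 1 - 2 * e k \<le> Re (\<phi> k (s k))" "\<And>k. 1 - 2 * e k \<le> Re (\<phi> (Suc k) (s k))" by metis
  have "vnorm X (s (Suc k) \<ominus>\<^bsub>X\<^esub> s k) \<le> (1/2)^k" for k
    using s(3)[of "Suc k"] s(4)[of k] decseqD[OF e(2), of k "Suc k"]
    by (intro close[where \<phi> = "\<phi> (Suc k)"] s \<phi>) auto
  from complete[OF s(1) this] obtain x where x: "x \<in> carrier X"
    and lim: "(\<lambda>k. vnorm X (s k \<ominus>\<^bsub>X\<^esub> x)) \<longlonglongrightarrow> 0" by blast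
  have Re_le: "Re (F \<psi>) \<le> Re (\<psi> x)" if \<psi>: "\<psi> \<in> bounded_functionals X" for \<psi>
  proof (rule field_le_epsilon)
    fix \<epsilon> :: real assume \<epsilon>: "0 < \<epsilon>"
    define N where "N = dual_norm \<psi>"
    have N: "0 \<le> N" unfolding N_def by (rule dual_norm_nonneg[OF \<psi>])
    define \<eta> where "\<eta> = min 1 (\<epsilon> / 4)"
    have \<eta>: "0 < \<eta>" "\<eta> \<le> 1" "4 * \<eta> \<le> \<epsilon>" using \<epsilon> by (auto simp: \<eta>_def)
    have "(\<lambda>j. N * (1/2::real)^j) \<longlonglongrightarrow> N * 0" by (intro tendsto_mult tendsto_const LIMSEQ_power_zero) simp
    then have "\<forall>\<^sub>F j in sequentially. N * (1/2)^j < \<eta>" using \<eta> by (intro order_tendstoD) auto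
    then obtain j where j: "N * (1/2)^j < \<eta>" by (auto simp: eventually_sequentially)
    \<comment> \<open>The size of the perturbation is tied to the accuracy \<open>j\<close>, and \<open>k\<close> is chosen afterwards so that
      \<open>e k\<close> is negligible even after division by \<open>t\<close>.\<close>
    define t where "t = e j / (2 * N + 1)"
    have t: "0 < t" "t * (2 * N + 1) = e j" using N e(1)[of j] by (auto simp: t_def)
    have "(\<lambda>k. N * vnorm X (s k \<ominus>\<^bsub>X\<^esub> x)) \<longlonglongrightarrow> N * 0" by (intro tendsto_mult tendsto_const lim)
    then have "\<forall>\<^sub>F k in sequentially. N * vnorm X (s k \<ominus>\<^bsub>X\<^esub> x) < \<eta> \<and> e k < t * \<eta> \<and> j \<le> k"
      using \<eta> t by (intro eventually_conj order_tendstoD[OF e(3)] order_tendstoD eventually_ge_at_top) auto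
    then obtain k where k: "N * vnorm X (s k \<ominus>\<^bsub>X\<^esub> x) < \<eta>" "e k < t * \<eta>" "j \<le> k"
      by (auto simp: eventually_sequentially)
    have ekj: "e k \<le> e j" by (rule decseqD[OF e(2) k(3)])
    let ?\<chi> = "\<lambda>y\<in>carrier X. \<phi> k y + (\<lambda>y\<in>carrier X. of_real t * \<psi> y) y"
    have \<chi>: "?\<chi> \<in> bounded_functionals X" by (intro functional_add_closed functional_smult_closed \<phi> \<psi>)
    have "Re (F (\<phi> k)) + t * Re (F \<psi>) - t * \<eta> < Re (F ?\<chi>)"
      using \<eta> t unfolding F_add[OF \<phi>(1) functional_smult_closed[OF \<psi>]] F_smult[OF \<psi>] by simp
    also have "\<dots> \<le> dual_norm ?\<chi>" by (rule F_le[OF \<chi>])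
    finally obtain y where y: "y \<in> carrier X" "vnorm X y \<le> 1"
      and "Re (F (\<phi> k)) + t * Re (F \<psi>) - t * \<eta> < Re (?\<chi> y)"
      by (rule nearly_norming[OF \<chi>])
    then have yk: "Re (F (\<phi> k)) + t * Re (F \<psi>) - t * \<eta> < Re (\<phi> k y) + t * Re (\<psi> y)" by simp
    have Fk: "1 - e k < Re (F (\<phi> k))" by (rule \<phi>(3))
    have "cmod (\<psi> y) \<le> N" unfolding N_def by (rule dual_norm_upper[OF \<psi> y])
    then have "Re (\<psi> y) \<le> N" using complex_Re_le_cmod[of "\<psi> y"] by simp
    then have 1: "t * Re (\<psi> y) \<le> t * N" using t by (intro mult_left_mono) auto
    have "cmod (F \<psi>) \<le> N" using D.functional_bound[OF F, of \<psi>] \<psi> by (simp add: F1 dual_space_simps(1) N_def)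
    then have "- N \<le> Re (F \<psi>)" using abs_Re_le_cmod[of "F \<psi>"] by simp
    then have "t * (- N) \<le> t * Re (F \<psi>)" using t by (intro mult_left_mono) auto
    moreover have "t * \<eta> \<le> t" using t \<eta> by simp
    ultimately have "1 - e k - e j < Re (\<phi> k y)" using 1 yk Fk t(2) by (simp add: algebra_simps)
    then have yj: "1 - 2 * e j \<le> Re (\<phi> k y)" using ekj by simp
    have "1 - 2 * e j \<le> Re (\<phi> k (s k))" using s(3)[of k] ekj by simp
    then have "vnorm X (y \<ominus>\<^bsub>X\<^esub> s k) \<le> (1/2)^j" by (intro close[OF y(1) s(1) y(2) s(2) \<phi>(1,2) yj])
    then have "N * vnorm X (y \<ominus>\<^bsub>X\<^esub> s k) \<le> N * (1/2)^j" using N by (intro mult_left_mono)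
    moreover have "cmod (\<psi> y - \<psi> (s k)) \<le> N * vnorm X (y \<ominus>\<^bsub>X\<^esub> s k)"
      using functional_bound[OF \<psi>, of "y \<ominus>\<^bsub>X\<^esub> s k"] y s(1)[of k] by (simp add: functional_diff[OF \<psi>] N_def)
    ultimately have 2: "Re (\<psi> y) - Re (\<psi> (s k)) \<le> \<eta>"
      using complex_Re_le_cmod[of "\<psi> y - \<psi> (s k)"] j by simp
    have "cmod (\<psi> (s k) - \<psi> x) \<le> N * vnorm X (s k \<ominus>\<^bsub>X\<^esub> x)"
      using functional_bound[OF \<psi>, of "s k \<ominus>\<^bsub>X\<^esub> x"] x s(1)[of k] by (simp add: functional_diff[OF \<psi>] N_def)
    then have 3: "Re (\<psi> (s k)) - Re (\<psi> x) \<le> \<eta>"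
      using complex_Re_le_cmod[of "\<psi> (s k) - \<psi> x"] k by simp
    have "t * Re (F \<psi>) \<le> t * (Re (\<psi> y) + 2 * \<eta>)"
      using yk Fk \<phi>_le[OF y, of k] k(2) by (simp add: algebra_simps)
    then have "Re (F \<psi>) \<le> Re (\<psi> y) + 2 * \<eta>" using t by simp
    then show "Re (F \<psi>) \<le> Re (\<psi> x) + \<epsilon>" using 2 3 \<eta> by simp
  qed
  \<comment> \<open>The inequality for \<open>\<psi>\<close> and \<open>- \<psi>\<close> gives equal real parts; \<open>\<i> \<psi>\<close> gives the imaginary parts.\<close>
  have Re_eq: "Re (F \<psi>) = Re (\<psi> x)" if \<psi>: "\<psi> \<in> bounded_functionals X" for \<psi>
    using Re_le[OF \<psi>] Re_le[OF functional_smult_closed[OF \<psi>, of "-1"]] F_smult[OF \<psi>, of "-1"] x by simp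
  have "F \<psi> = \<psi> x" if \<psi>: "\<psi> \<in> bounded_functionals X" for \<psi>
    using Re_eq[OF \<psi>] Re_eq[OF functional_smult_closed[OF \<psi>, of "\<i>"]] F_smult[OF \<psi>, of "\<i>"] x
    by (simp add: complex_eq_iff)
  with x show thesis by (rule that)
qed

theorem milman_pettis: "reflexive_space X"
  unfolding reflexive_space_def
proof (intro conjI cns subset_antisym subsetI)
  interpret D: complex_normed "dual_space X" by standard (rule dual_complex_normed)
  interpret DD: complex_normed "dual_space (dual_space X)" by standard (rule D.dual_complex_normed)
  fix F assume "F \<in> carrier (dual_space (dual_space X))"
  then have F: "F \<in> bounded_functionals (dual_space X)" by (simp add: D.dual_space_simps)
  have "\<exists>x\<in>carrier X. \<forall>\<phi>\<in>bounded_functionals X. F \<phi> = \<phi> x"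
  proof (cases "D.dual_norm F = 0")
    case True
    have "F \<phi> = \<phi> \<zero>\<^bsub>X\<^esub>" if "\<phi> \<in> bounded_functionals X" for \<phi>
      using D.functional_bound[OF F, of \<phi>] functional_smult[OF that, of "\<zero>\<^bsub>X\<^esub>" 0] that True
      by (simp add: dual_space_simps(1) smult_r_null)
    then show ?thesis by blast
  next
    case False
    define K where "K = D.dual_norm F"
    have K: "K > 0" using False D.dual_norm_nonneg[OF F] by (simp add: K_def)
    let ?G = "of_real (1 / K) \<odot>\<^bsub>dual_space (dual_space X)\<^esub> F"
    have "D.dual_norm ?G = 1" using F K DD.norm_smult[of F "of_real (1 / K)"]
      by (simp add: D.dual_space_simps(1) K_def[symmetric] norm_divide)
    moreover have "?G \<in> bounded_functionals (dual_space X)"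
      unfolding D.dual_space_simps(4) by (rule D.functional_smult_closed[OF F])
    ultimately obtain x where x: "x \<in> carrier X" "\<And>\<phi>. \<phi> \<in> bounded_functionals X \<Longrightarrow> ?G \<phi> = \<phi> x"
      using bidual_unit_represented by blast
    have "F \<phi> = \<phi> (of_real K \<odot>\<^bsub>X\<^esub> x)" if "\<phi> \<in> bounded_functionals X" for \<phi>
      using x(2)[OF that] K that
      by (simp add: functional_smult[OF that x(1)] D.dual_space_simps dual_space_simps(1) field_simps)
    then show ?thesis using smult_in[OF x(1)] by blast
  qed
  then obtain x where x: "x \<in> carrier X" "\<And>\<phi>. \<phi> \<in> bounded_functionals X \<Longrightarrow> F \<phi> = \<phi> x" by blast
  have "F = canonical_embedding X x"
    using canonical_embedding_in_bidual[OF x(1)] x(2)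
    by (intro D.functional_ext F) (auto simp: D.dual_space_simps(1) canonical_embedding_def dual_space_simps(1))
  with x(1) show "F \<in> canonical_embedding X ` carrier X" by blast
qed (auto intro: canonical_embedding_in_bidual)

end

section \<open>Spaces of functions modulo null sets\<close>

text \<open>The pointwise half of the Riesz-Fischer argument: a sequence with summable increments
  converges, and its distance to the limit is at most the tail of the increments.\<close>

lemma tail_bound_of_finite_variation:
  fixes z :: "nat \<Rightarrow> complex"
  assumes fin: "(\<Sum>j. ennreal (cmod (z (Suc j) - z j))) < \<infinity>"
  shows "ennreal (cmod (z K - lim z)) \<le> (\<Sum>j. ennreal (cmod (z (Suc (j + K)) - z (j + K))))"
proof -
  have sm: "summable (\<lambda>j. cmod (z (Suc j) - z j))"
    using fin by (intro summable_suminf_not_top) auto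
  then have "summable (\<lambda>j. z (Suc j) - z j)" by (rule summable_norm_cancel)
  then have "convergent (\<lambda>n. \<Sum>j<n. z (Suc j) - z j)" by (simp add: summable_iff_convergent)
  then have "convergent (\<lambda>n. z n - z 0)" by (simp add: sum_lessThan_telescope)
  then have "convergent (\<lambda>n. (z n - z 0) + z 0)" by (intro convergent_add convergent_const)
  then have lim: "z \<longlonglongrightarrow> lim z" by (simp add: convergent_LIMSEQ_iff)
  have smK: "summable (\<lambda>j. cmod (z (Suc (j + K)) - z (j + K)))"
    using sm by (subst summable_iff_shift[of "\<lambda>j. cmod (z (Suc j) - z j)" K])
  have "(\<lambda>n. z (n + K) - z (0 + K)) \<longlonglongrightarrow> lim z - z (0 + K)"
    by (intro tendsto_diff tendsto_const LIMSEQ_ignore_initial_segment lim)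
  then have "(\<lambda>j. z (Suc (j + K)) - z (j + K)) sums (lim z - z K)"
    using sum_lessThan_telescope[of "\<lambda>n. z (n + K)"] by (simp add: sums_def)
  then have "cmod (lim z - z K) \<le> (\<Sum>j. cmod (z (Suc (j + K)) - z (j + K)))"
    using summable_norm[OF smK] by (simp add: sums_iff)
  then have "ennreal (cmod (z K - lim z)) \<le> ennreal (\<Sum>j. cmod (z (Suc (j + K)) - z (j + K)))"
    by (intro ennreal_leI) (simp add: norm_minus_commute)
  also have "\<dots> = (\<Sum>j. ennreal (cmod (z (Suc (j + K)) - z (j + K))))"
    by (rule suminf_ennreal2[symmetric]) (use smK in auto)
  finally show ?thesis .
qed

text \<open>Only measurable \<open>f\<close> have a class; the set is empty for the others, as it is for the
  image of a single function under the almost-everywhere relation.\<close>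

definition ae_class :: "'a measure \<Rightarrow> ('a \<Rightarrow> complex) \<Rightarrow> ('a \<Rightarrow> complex) set" where
  "ae_class M f = {g. f \<in> borel_measurable M \<and> g \<in> borel_measurable M \<and> (AE x in M. f x = g x)}"

definition function_space ::
    "'a measure \<Rightarrow> (('a \<Rightarrow> ennreal) \<Rightarrow> ennreal) \<Rightarrow> ('a \<Rightarrow> complex) set normed_module" where
  "function_space M \<rho> =
     \<lparr>carrier = ae_class M ` {f \<in> borel_measurable M. \<rho> (\<lambda>x. ennreal (cmod (f x))) < \<infinity>},
      mult = undefined,
      one = undefined,
      zero = ae_class M (\<lambda>_. 0),
      add = (\<lambda>A B. \<Union>f\<in>A. \<Union>g\<in>B. ae_class M (\<lambda>x. f x + g x)),
      smult = (\<lambda>c A. \<Union>f\<in>A. ae_class M (\<lambda>x. c * f x)),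
      vnorm = (\<lambda>A. enn2real (the_elem ((\<lambda>f. \<rho> (\<lambda>x. ennreal (cmod (f x)))) ` A)))\<rparr>"

lemma ae_class_self: "f \<in> borel_measurable M \<Longrightarrow> f \<in> ae_class M f"
  by (simp add: ae_class_def)

lemma ae_class_eqI:
  "f \<in> borel_measurable M \<Longrightarrow> g \<in> borel_measurable M \<Longrightarrow> AE x in M. f x = g x \<Longrightarrow> ae_class M f = ae_class M g"
  unfolding ae_class_def by auto

text \<open>A norm on nonnegative measurable functions, allowed to be infinite, with the properties
  shared by all Lebesgue-type norms. They suffice for the classes of functions \<open>f\<close> with
  \<open>\<rho> \<bar>f\<bar> < \<infinity>\<close> to form a Banach space.\<close>

locale function_norm =
  fixes M :: "'a measure" and \<rho> :: "('a \<Rightarrow> ennreal) \<Rightarrow> ennreal"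
  assumes mono: "\<And>u v. \<lbrakk>u \<in> borel_measurable M; v \<in> borel_measurable M; AE x in M. u x \<le> v x\<rbrakk> \<Longrightarrow> \<rho> u \<le> \<rho> v"
    and cmult: "\<And>c u. 0 \<le> c \<Longrightarrow> u \<in> borel_measurable M \<Longrightarrow> \<rho> (\<lambda>x. ennreal c * u x) = ennreal c * \<rho> u"
    and countably_subadditive:
      "\<And>u. (\<And>j. u j \<in> borel_measurable M) \<Longrightarrow> \<rho> (\<lambda>x. \<Sum>j. u j x) \<le> (\<Sum>j::nat. \<rho> (u j))"
    and null: "\<And>u. u \<in> borel_measurable M \<Longrightarrow> \<rho> u = 0 \<Longrightarrow> AE x in M. u x = 0"
begin

abbreviation "N f \<equiv> \<rho> (\<lambda>x. ennreal (cmod (f x)))"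

lemma zero: "\<rho> (\<lambda>_. 0) = 0"
  using cmult[of 0 "\<lambda>_. 0"] by simp

lemma subadditive:
  assumes [measurable]: "u \<in> borel_measurable M" "v \<in> borel_measurable M"
  shows "\<rho> (\<lambda>x. u x + v x) \<le> \<rho> u + \<rho> v"
proof -
  define w where "w j = (if j = 0 then u else if j = 1 then v else (\<lambda>_. 0))" for j :: nat
  have *: "(\<Sum>j. (F (w j) :: ennreal)) = F u + F v" if "F (\<lambda>_. 0) = 0" for F
  proof -
    have "(\<Sum>j. F (w j)) = (\<Sum>j\<in>{0,1}. F (w j))"
      by (rule suminf_finite) (auto simp: w_def that)
    then show ?thesis by (simp add: w_def)
  qed
  have "\<rho> (\<lambda>x. \<Sum>j. w j x) \<le> (\<Sum>j. \<rho> (w j))"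
    by (rule countably_subadditive) (simp add: w_def)
  then show ?thesis using *[of \<rho>] *[of "\<lambda>u. u x" for x] zero by simp
qed

text \<open>The indicator of the set where \<open>u\<close> is infinite, times any natural number, lies below
  \<open>u\<close>; so its norm vanishes.\<close>

lemma finite_AE:
  assumes [measurable]: "u \<in> borel_measurable M" and fin: "\<rho> u < \<infinity>"
  shows "AE x in M. u x < \<infinity>"
proof -
  define v :: "'a \<Rightarrow> ennreal" where "v x = (if u x = \<infinity> then 1 else 0)" for x
  have [measurable]: "v \<in> borel_measurable M" unfolding v_def by measurable
  have le: "ennreal (real k) * \<rho> v \<le> \<rho> u" for k :: nat
  proof -
    have "ennreal (real k) * \<rho> v = \<rho> (\<lambda>x. ennreal (real k) * v x)" by (simp add: cmult)
    also have "\<dots> \<le> \<rho> u" by (rule mono) (auto simp: v_def)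
    finally show ?thesis .
  qed
  have "\<rho> v = 0"
  proof (rule ccontr)
    assume nz: "\<rho> v \<noteq> 0"
    have "\<rho> v < \<infinity>" using le[of 1] fin by (simp add: order.strict_trans1)
    then obtain b where b: "\<rho> v = ennreal b" "b > 0"
      using nz by (cases "\<rho> v") (auto simp: less_le)
    obtain a where a: "\<rho> u = ennreal a" "a \<ge> 0" using fin by (cases "\<rho> u") auto
    obtain k where "a / b < real k" using reals_Archimedean2 by blast
    then have "a < real k * b" using b by (simp add: field_simps)
    moreover have "ennreal (real k * b) \<le> ennreal a" using le[of k] a b by (simp add: ennreal_mult)
    ultimately show False using a by (simp add: ennreal_le_iff)
  qed
  then have "AE x in M. v x = 0" by (intro null) auto
  then show ?thesis by eventually_elim (auto simp: v_def less_top split: if_splits)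
qed

lemma N_cong:
  assumes [measurable]: "f \<in> borel_measurable M" "g \<in> borel_measurable M" and "AE x in M. f x = g x"
  shows "N f = N g"
  by (rule antisym; rule mono) (use assms(3) in \<open>auto elim!: eventually_mono\<close>)

lemma N_add:
  assumes [measurable]: "f \<in> borel_measurable M" "g \<in> borel_measurable M"
  shows "N (\<lambda>x. f x + g x) \<le> N f + N g"
proof -
  have "N (\<lambda>x. f x + g x) \<le> \<rho> (\<lambda>x. ennreal (cmod (f x)) + ennreal (cmod (g x)))"
    by (rule mono) (auto simp flip: ennreal_plus intro!: norm_triangle_ineq)
  also have "\<dots> \<le> N f + N g" by (rule subadditive) auto
  finally show ?thesis .
qed

lemma N_smult:
  assumes [measurable]: "f \<in> borel_measurable M"
  shows "N (\<lambda>x. c * f x) = ennreal (cmod c) * N f"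
  using cmult[of "cmod c" "\<lambda>x. ennreal (cmod (f x))"] by (simp add: norm_mult ennreal_mult)

abbreviation "E \<equiv> function_space M \<rho>"
abbreviation "cls \<equiv> ae_class M"

lemma carrier_iff: "A \<in> carrier E \<longleftrightarrow> (\<exists>f. A = cls f \<and> f \<in> borel_measurable M \<and> N f < \<infinity>)"
  by (auto simp: function_space_def)

lemma class_in_carrier: "f \<in> borel_measurable M \<Longrightarrow> N f < \<infinity> \<Longrightarrow> cls f \<in> carrier E"
  by (auto simp: carrier_iff)

lemma add_class:
  assumes [measurable]: "f \<in> borel_measurable M" "g \<in> borel_measurable M"
  shows "cls f \<oplus>\<^bsub>E\<^esub> cls g = cls (\<lambda>x. f x + g x)"
proof -
  have "cls (\<lambda>x. f' x + g' x) = cls (\<lambda>x. f x + g x)" if "f' \<in> cls f" "g' \<in> cls g" for f' g'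
    using that by (intro ae_class_eqI) (auto simp: ae_class_def)
  then have "(\<Union>f'\<in>cls f. \<Union>g'\<in>cls g. cls (\<lambda>x. f' x + g' x)) =
      (\<Union>f'\<in>cls f. \<Union>g'\<in>cls g. cls (\<lambda>x. f x + g x))"
    by (intro SUP_cong refl)
  also have "\<dots> = cls (\<lambda>x. f x + g x)"
    using ae_class_self[OF assms(1)] ae_class_self[OF assms(2)] by blast
  finally show ?thesis by (simp add: function_space_def)
qed

lemma smult_class:
  assumes [measurable]: "f \<in> borel_measurable M"
  shows "c \<odot>\<^bsub>E\<^esub> cls f = cls (\<lambda>x. c * f x)"
proof -
  have "cls (\<lambda>x. c * f' x) = cls (\<lambda>x. c * f x)" if "f' \<in> cls f" for f'
  proof -
    have f': "f' \<in> borel_measurable M" "AE x in M. f x = f' x" using that by (auto simp: ae_class_def)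
    have "AE x in M. c * f' x = c * f x" by (rule eventually_mono[OF f'(2)]) simp
    then show ?thesis
      by (rule ae_class_eqI[rotated 2]; intro borel_measurable_times borel_measurable_const f'(1) assms)
  qed
  then have "(\<Union>f'\<in>cls f. cls (\<lambda>x. c * f' x)) = (\<Union>f'\<in>cls f. cls (\<lambda>x. c * f x))"
    by (intro SUP_cong refl)
  also have "\<dots> = cls (\<lambda>x. c * f x)"
    using ae_class_self[OF assms(1)] by blast
  finally show ?thesis by (simp add: function_space_def)
qed

lemma vnorm_class:
  assumes "f \<in> borel_measurable M"
  shows "vnorm E (cls f) = enn2real (N f)"
proof -
  have "N g = N f" if "g \<in> cls f" for g
    using that unfolding ae_class_def by (intro N_cong) (auto elim: eventually_mono)
  then have "(\<lambda>f. N f) ` cls f = {N f}"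
    using ae_class_self[OF assms] by blast
  then show ?thesis by (simp add: function_space_def)
qed

lemma zero_class: "\<zero>\<^bsub>E\<^esub> = cls (\<lambda>_. 0)"
  by (simp add: function_space_def)

lemma N_add_finite:
  assumes "f \<in> borel_measurable M" "g \<in> borel_measurable M" "N f < \<infinity>" "N g < \<infinity>"
  shows "N (\<lambda>x. f x + g x) < \<infinity>"
  using N_add[OF assms(1,2)] assms(3,4) by (auto simp: order.strict_trans1)

lemma N_smult_finite: "f \<in> borel_measurable M \<Longrightarrow> N f < \<infinity> \<Longrightarrow> N (\<lambda>x. c * f x) < \<infinity>"
  by (simp add: N_smult ennreal_mult_less_top)

lemma complex_normed_space: "complex_normed_space E"
  unfolding complex_normed_space_def
proof (intro conjI ballI allI)
  have add_in: "cls (\<lambda>x. f x + g x) \<in> carrier E" and smult_in: "cls (\<lambda>x. c * f x) \<in> carrier E"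
    if "f \<in> borel_measurable M" "N f < \<infinity>" "g \<in> borel_measurable M" "N g < \<infinity>" for f g c
    using that by (auto intro!: class_in_carrier N_add_finite N_smult_finite simp del: infinity_ennreal_def)
  have add_meas: "f \<in> borel_measurable M \<Longrightarrow> g \<in> borel_measurable M \<Longrightarrow> (\<lambda>x. f x + g x) \<in> borel_measurable M"
    and smult_meas: "f \<in> borel_measurable M \<Longrightarrow> (\<lambda>x. c * f x) \<in> borel_measurable M"
    for f g :: "'a \<Rightarrow> complex" and c by auto
  show "module complex_field E"
  proof (rule moduleI[OF cring_complex_field])
    show "abelian_group E"
    proof (rule abelian_groupI)
      fix A B C assume "A \<in> carrier E" "B \<in> carrier E" "C \<in> carrier E"
      then obtain f g h where f: "A = cls f" "f \<in> borel_measurable M" "N f < \<infinity>"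
        and g: "B = cls g" "g \<in> borel_measurable M" "N g < \<infinity>"
        and h: "C = cls h" "h \<in> borel_measurable M" "N h < \<infinity>" unfolding carrier_iff by blast
      show "A \<oplus>\<^bsub>E\<^esub> B \<in> carrier E" using f g by (simp add: add_class add_in)
      show "A \<oplus>\<^bsub>E\<^esub> B \<oplus>\<^bsub>E\<^esub> C = A \<oplus>\<^bsub>E\<^esub> (B \<oplus>\<^bsub>E\<^esub> C)"
        using f(2) g(2) h(2) unfolding f(1) g(1) h(1) by (simp only: add_class add_meas add.assoc)
      show "A \<oplus>\<^bsub>E\<^esub> B = B \<oplus>\<^bsub>E\<^esub> A"
        using f(2) g(2) unfolding f(1) g(1) by (simp only: add_class add.commute)
    next
      fix A assume "A \<in> carrier E"
      then obtain f where f: "A = cls f" "f \<in> borel_measurable M" "N f < \<infinity>" unfolding carrier_iff by blast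
      show "\<exists>B\<in>carrier E. B \<oplus>\<^bsub>E\<^esub> A = \<zero>\<^bsub>E\<^esub>"
      proof (rule bexI)
        show "cls (\<lambda>x. (-1) * f x) \<oplus>\<^bsub>E\<^esub> A = \<zero>\<^bsub>E\<^esub>"
          unfolding f(1) zero_class by (subst add_class) (use f(2) in auto)
        show "cls (\<lambda>x. (-1) * f x) \<in> carrier E" by (rule smult_in[OF f(2,3) f(2,3)])
      qed
      show "\<zero>\<^bsub>E\<^esub> \<oplus>\<^bsub>E\<^esub> A = A" using f by (simp add: zero_class add_class)
    next
      show "\<zero>\<^bsub>E\<^esub> \<in> carrier E" by (simp add: zero_class class_in_carrier zero)
    qed
  next
    fix a b :: complex and A B assume "A \<in> carrier E" "B \<in> carrier E"
    then obtain f g where f: "A = cls f" "f \<in> borel_measurable M" "N f < \<infinity>"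
        and g: "B = cls g" "g \<in> borel_measurable M" "N g < \<infinity>" unfolding carrier_iff by blast
    note meas = f(2) g(2) add_meas smult_meas
    show "a \<odot>\<^bsub>E\<^esub> A \<in> carrier E" using smult_in[OF f(2,3) f(2,3)] f by (simp only: smult_class)
    show "(a \<oplus>\<^bsub>complex_field\<^esub> b) \<odot>\<^bsub>E\<^esub> A = a \<odot>\<^bsub>E\<^esub> A \<oplus>\<^bsub>E\<^esub> b \<odot>\<^bsub>E\<^esub> A"
      unfolding f(1) by (simp only: smult_class add_class meas complex_field_simps ring_distribs)
    show "a \<odot>\<^bsub>E\<^esub> (A \<oplus>\<^bsub>E\<^esub> B) = a \<odot>\<^bsub>E\<^esub> A \<oplus>\<^bsub>E\<^esub> a \<odot>\<^bsub>E\<^esub> B"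
      unfolding f(1) g(1) by (simp only: smult_class add_class meas ring_distribs)
    show "(a \<otimes>\<^bsub>complex_field\<^esub> b) \<odot>\<^bsub>E\<^esub> A = a \<odot>\<^bsub>E\<^esub> (b \<odot>\<^bsub>E\<^esub> A)"
      unfolding f(1) by (simp only: smult_class meas complex_field_simps mult.assoc)
    show "\<one>\<^bsub>complex_field\<^esub> \<odot>\<^bsub>E\<^esub> A = A"
      unfolding f(1) by (simp only: smult_class meas complex_field_simps mult_1_left)
  qed
next
  fix A assume "A \<in> carrier E"
  then obtain f where f: "A = cls f" "f \<in> borel_measurable M" "N f < \<infinity>" by (auto simp: carrier_iff)
  note [measurable] = f(2)
  show "0 \<le> vnorm E A" using f by (simp add: vnorm_class)
  show "vnorm E A = 0 \<longleftrightarrow> A = \<zero>\<^bsub>E\<^esub>"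
  proof
    assume "vnorm E A = 0"
    then have "N f = 0" using f by (auto simp: vnorm_class enn2real_eq_0_iff)
    then have "AE x in M. ennreal (cmod (f x)) = 0" by (intro null) auto
    then show "A = \<zero>\<^bsub>E\<^esub>" unfolding f(1) zero_class by (intro ae_class_eqI) auto
  next
    assume "A = \<zero>\<^bsub>E\<^esub>" then show "vnorm E A = 0" by (simp add: zero_class vnorm_class zero)
  qed
  show "vnorm E (c \<odot>\<^bsub>E\<^esub> A) = cmod c * vnorm E A" for c
    using f by (simp add: smult_class vnorm_class N_smult enn2real_mult)
next
  fix A B assume "A \<in> carrier E" "B \<in> carrier E"
  then obtain f g where fg: "A = cls f" "f \<in> borel_measurable M" "N f < \<infinity>"
     "B = cls g" "g \<in> borel_measurable M" "N g < \<infinity>" by (auto simp: carrier_iff)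
  have "enn2real (N (\<lambda>x. f x + g x)) \<le> enn2real (N f + N g)"
    using fg by (intro enn2real_mono N_add) auto
  also have "\<dots> = enn2real (N f) + enn2real (N g)" using fg by (intro enn2real_plus) auto
  finally show "vnorm E (A \<oplus>\<^bsub>E\<^esub> B) \<le> vnorm E A + vnorm E B"
    using fg by (simp add: add_class vnorm_class)
qed

sublocale E: complex_normed E
  by standard (rule complex_normed_space)

lemma diff_class:
  assumes "f \<in> borel_measurable M" "g \<in> borel_measurable M" "N g < \<infinity>"
  shows "cls f \<ominus>\<^bsub>E\<^esub> cls g = cls (\<lambda>x. f x - g x)"
  using assms by (simp add: E.diff_eq_smult class_in_carrier smult_class add_class)

lemma N_diff_finite:
  assumes "f \<in> borel_measurable M" "g \<in> borel_measurable M" "N f < \<infinity>" "N g < \<infinity>"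
  shows "N (\<lambda>x. f x - g x) < \<infinity>"
  using N_add_finite[of f "\<lambda>x. (-1) * g x"] N_smult_finite[of g "-1"] assms by simp

text \<open>The increments of the representatives sum to a function \<open>H\<close> with \<open>\<rho> H \<le> 2\<close> by
  countable subadditivity, so \<open>H\<close> is finite almost everywhere, the representatives converge
  there, and the tails of the series bound the error in norm.\<close>

lemma riesz_fischer:
  assumes s: "\<And>k. s k \<in> carrier E"
    and fast: "\<And>k. vnorm E (s (Suc k) \<ominus>\<^bsub>E\<^esub> s k) \<le> (1/2)^k"
  shows "\<exists>x\<in>carrier E. (\<lambda>k. vnorm E (s k \<ominus>\<^bsub>E\<^esub> x)) \<longlonglongrightarrow> 0"
proof -
  have "\<forall>k. \<exists>f. s k = cls f \<and> f \<in> borel_measurable M \<and> N f < \<infinity>" using s by (simp add: carrier_iff)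
  then obtain f where f: "\<And>k. s k = cls (f k)" "\<And>k. f k \<in> borel_measurable M" "\<And>k. N (f k) < \<infinity>"
    by metis
  note [measurable] = f(2)
  define h where "h k x = ennreal (cmod (f (Suc k) x - f k x))" for k x
  have [measurable]: "h k \<in> borel_measurable M" for k unfolding h_def by measurable
  have h: "\<rho> (h k) \<le> ennreal ((1/2)^k)" for k
  proof -
    have h_eq: "h k = (\<lambda>x. ennreal (cmod (f (Suc k) x - f k x)))" by (rule ext) (rule h_def)
    have "enn2real (\<rho> (h k)) \<le> (1/2)^k"
      using fast[of k] unfolding f(1) h_eq diff_class[OF f(2) f(2) f(3)]
      by (subst (asm) vnorm_class) auto
    moreover have "\<rho> (h k) < \<infinity>" unfolding h_eq by (intro N_diff_finite f)
    ultimately show ?thesis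
      using ennreal_leI[of "enn2real (\<rho> (h k))" "(1/2)^k"] by (simp only: ennreal_enn2real infinity_ennreal_def)
  qed
  have tail: "\<rho> (\<lambda>x. \<Sum>j. h (j + K) x) \<le> ennreal (2 * (1/2)^K)" for K
  proof -
    have geo: "(\<lambda>j. (1/2::real)^(j + K)) sums (2 * (1/2)^K)"
      using sums_mult2[OF geometric_sums[of "1/2::real"], of "(1/2)^K"] by (simp add: power_add)
    have "\<rho> (\<lambda>x. \<Sum>j. h (j + K) x) \<le> (\<Sum>j. \<rho> (h (j + K)))"
      by (rule countably_subadditive) measurable
    also have "\<dots> \<le> (\<Sum>j. ennreal ((1/2)^(j + K)))" by (intro suminf_le h) auto
    also have "\<dots> = ennreal (2 * (1/2)^K)"
      using geo by (subst suminf_ennreal2) (auto simp: sums_iff)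
    finally show ?thesis .
  qed
  have "AE x in M. (\<Sum>j. h (j + 0) x) < \<infinity>"
    by (rule finite_AE) (use tail[of 0] in \<open>auto intro: order.strict_trans1\<close>)
  define g where "g x = lim (\<lambda>k. f k x)" for x
  have [measurable]: "g \<in> borel_measurable M" unfolding g_def by measurable
  have ae: "AE x in M. ennreal (cmod (f K x - g x)) \<le> (\<Sum>j. h (j + K) x)" for K
    using \<open>AE x in M. (\<Sum>j. h (j + 0) x) < \<infinity>\<close>
  proof eventually_elim
    case (elim x)
    then show ?case unfolding h_def g_def add_0_right by (rule tail_bound_of_finite_variation)
  qed
  have N_le: "N (\<lambda>x. f K x - g x) \<le> ennreal (2 * (1/2)^K)" for K
  proof -
    have "N (\<lambda>x. f K x - g x) \<le> \<rho> (\<lambda>x. \<Sum>j. h (j + K) x)" by (rule mono[OF _ _ ae]) auto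
    then show ?thesis using tail[of K] by (rule order_trans)
  qed
  have "N (\<lambda>x. f 0 x - g x) < \<infinity>" using N_le[of 0] by (auto intro: order.strict_trans1)
  then have "N (\<lambda>x. f 0 x - (f 0 x - g x)) < \<infinity>" by (intro N_diff_finite[OF f(2) _ f(3), of "\<lambda>x. f 0 x - g x"]) auto
  then have g: "N g < \<infinity>" by simp
  have "(\<lambda>k. vnorm E (s k \<ominus>\<^bsub>E\<^esub> cls g)) \<longlonglongrightarrow> 0"
  proof (rule tendsto_sandwich[of "\<lambda>_. 0" _ sequentially "\<lambda>k. 2 * (1/2)^k"])
    show "\<forall>\<^sub>F k in sequentially. vnorm E (s k \<ominus>\<^bsub>E\<^esub> cls g) \<le> 2 * (1/2)^k"
    proof (rule always_eventually, rule allI)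
      fix k
      have "vnorm E (s k \<ominus>\<^bsub>E\<^esub> cls g) = enn2real (N (\<lambda>x. f k x - g x))"
        by (simp add: f(1) diff_class[OF f(2) _ g] vnorm_class)
      also have "\<dots> \<le> enn2real (ennreal (2 * (1/2)^k))" by (intro enn2real_mono N_le) auto
      finally show "vnorm E (s k \<ominus>\<^bsub>E\<^esub> cls g) \<le> 2 * (1/2)^k" by simp
    qed
    have "(\<lambda>k. 2 * (1/2::real)^k) \<longlonglongrightarrow> 2 * 0" by (intro tendsto_mult tendsto_const LIMSEQ_power_zero) simp
    then show "(\<lambda>k. 2 * (1/2::real)^k) \<longlonglongrightarrow> 0" by simp
  qed (auto simp: f(1) diff_class[OF f(2) _ g] vnorm_class)
  then show ?thesis using g by (intro bexI[of _ "cls g"] class_in_carrier) auto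
qed

text \<open>On the unit ball the inequality reads \<open>d\<^sup>r \<le> 2 e' + C (1 - m\<^sup>r)\<close>, which is at most
  \<open>e\<^sup>r\<close> once \<open>e' = e\<^sup>r / 4\<close> and \<open>m\<^sup>r \<ge> 1 - 2 e' / C\<close>; the threshold \<open>\<theta>\<close> expresses the
  latter through the norm \<open>2 m\<close> of the sum.\<close>

theorem reflexive_if_power_convex:
  fixes r :: real
  assumes r: "0 < r"
    and conv: "\<And>e. 0 < e \<Longrightarrow> \<exists>C>0. \<forall>f g. f \<in> borel_measurable M \<longrightarrow> g \<in> borel_measurable M \<longrightarrow>
       epowr (N (\<lambda>x. f x - g x)) r + ennreal C * epowr (N (\<lambda>x. (f x + g x) / 2)) r
         \<le> ennreal (e + C / 2) * (epowr (N f) r + epowr (N g) r)"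
  shows "reflexive_space E"
proof -
  have "uniformly_convex E"
  proof (intro uniformly_convex.intro E.complex_normed_axioms uniformly_convex_axioms.intro)
    fix e :: real assume e: "0 < e"
    define e' where "e' = e powr r / 4"
    have e': "0 < e'" using e by (simp add: e'_def)
    from conv[OF e'] obtain C where C: "C > 0"
      and ineq: "\<And>f g. f \<in> borel_measurable M \<Longrightarrow> g \<in> borel_measurable M \<Longrightarrow>
       epowr (N (\<lambda>x. f x - g x)) r + ennreal C * epowr (N (\<lambda>x. (f x + g x) / 2)) r
         \<le> ennreal (e' + C / 2) * (epowr (N f) r + epowr (N g) r)" by blast
    define \<theta> where "\<theta> = max 0 (1 - 2 * e' / C)"
    have \<theta>: "0 \<le> \<theta>" "\<theta> < 1" "1 - 2 * e' / C \<le> \<theta>" using e' C by (auto simp: \<theta>_def)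
    define d where "d = 2 * (1 - \<theta> powr (1 / r))"
    have "\<theta> powr (1 / r) < 1 powr (1 / r)" using \<theta> r by (intro powr_less_mono2) auto
    then have d: "0 < d" by (simp add: d_def)
    have "vnorm E (A \<ominus>\<^bsub>E\<^esub> B) \<le> e"
      if A: "A \<in> carrier E" and B: "B \<in> carrier E" and A1: "vnorm E A \<le> 1" and B1: "vnorm E B \<le> 1"
       and AB: "2 - d \<le> vnorm E (A \<oplus>\<^bsub>E\<^esub> B)" for A B
    proof -
      from A B obtain f g where fg: "A = cls f" "f \<in> borel_measurable M" "N f < \<infinity>"
        "B = cls g" "g \<in> borel_measurable M" "N g < \<infinity>" by (auto simp: carrier_iff)
      note [measurable] = fg(2,5)
      define a b m k where "a = enn2real (N f)" and "b = enn2real (N g)"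
        and "m = enn2real (N (\<lambda>x. (f x + g x) / 2))" and "k = enn2real (N (\<lambda>x. f x - g x))"
      have mean: "N (\<lambda>x. (f x + g x) / 2) = ennreal (1/2) * N (\<lambda>x. f x + g x)"
        using N_smult[of "\<lambda>x. f x + g x" "1/2"] by (simp add: norm_divide)
      have fin: "N (\<lambda>x. f x + g x) < \<infinity>" "N (\<lambda>x. f x - g x) < \<infinity>"
        by (rule N_add_finite[OF fg(2,5,3,6)], rule N_diff_finite[OF fg(2,5,3,6)])
      have finm: "N (\<lambda>x. (f x + g x) / 2) < \<infinity>"
        unfolding mean using fin(1) ennreal_less_top[of "1/2"]
        by (simp only: infinity_ennreal_def ennreal_mult_less_top simp_thms)
      have Nr: "N f = ennreal a" "N g = ennreal b" "N (\<lambda>x. (f x + g x) / 2) = ennreal m"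
          "N (\<lambda>x. f x - g x) = ennreal k"
        using fg fin finm by (simp_all only: a_def b_def m_def k_def ennreal_enn2real infinity_ennreal_def)
      have nn: "0 \<le> a" "0 \<le> b" "0 \<le> m" "0 \<le> k" by (auto simp: a_def b_def m_def k_def)
      have ab: "a \<le> 1" "b \<le> 1" using A1 B1 fg by (simp_all add: vnorm_class a_def b_def)
      have "2 * m = enn2real (N (\<lambda>x. f x + g x))" unfolding m_def mean by (simp only: enn2real_mult enn2real_ennreal)
      then have "2 - d \<le> 2 * m" using AB fg by (simp add: add_class vnorm_class)
      then have "\<theta> powr (1 / r) \<le> m" by (simp add: d_def)
      then have "(\<theta> powr (1 / r)) powr r \<le> m powr r" using r by (intro powr_mono2) auto
      then have m: "1 - 2 * e' / C \<le> m powr r" using \<theta> r by (simp add: powr_powr)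
      have "ennreal (k powr r + C * m powr r) \<le> ennreal ((e' + C / 2) * (a powr r + b powr r))"
        using ineq[OF fg(2,5)] C e' nn unfolding Nr by (simp add: epowr_ennreal ennreal_mult ennreal_plus)
      then have "k powr r + C * m powr r \<le> (e' + C / 2) * (a powr r + b powr r)"
        using C e' by (subst (asm) ennreal_le_iff) auto
      also have "\<dots> \<le> (e' + C / 2) * (1 + 1)"
        using C e' ab nn r by (intro mult_left_mono add_mono powr_le1) auto
      finally have "k powr r \<le> 2 * e' + C * (1 - m powr r)" by (simp add: algebra_simps)
      also have "\<dots> \<le> 2 * e' + C * (2 * e' / C)" using C m by (intro add_left_mono mult_left_mono) auto
      also have "\<dots> = e powr r" using C by (simp add: e'_def)
      finally have "k \<le> e" using powr_less_mono2[OF r, of e k] e by (cases "k \<le> e") auto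
      then show ?thesis using fg by (simp add: diff_class vnorm_class k_def)
    qed
    then show "\<exists>d>0. \<forall>x\<in>carrier E. \<forall>y\<in>carrier E. vnorm E x \<le> 1 \<longrightarrow>
      vnorm E y \<le> 1 \<longrightarrow> 2 - d \<le> vnorm E (x \<oplus>\<^bsub>E\<^esub> y) \<longrightarrow> vnorm E (x \<ominus>\<^bsub>E\<^esub> y) \<le> e"
      using d by blast
  qed (rule riesz_fischer)
  then show ?thesis by (rule uniformly_convex.milman_pettis)
qed

end

section \<open>Iterated norms of functions of several variables\<close>

lemma section_measurable:
  assumes "u \<in> borel_measurable (PiM (insert i I) M)" "x \<in> space (PiM I M)"
  shows "(\<lambda>y. u (x(i := y))) \<in> borel_measurable (M i)"
  using measurable_compose[OF measurable_compose[OF measurable_Pair1'[OF assms(2)] measurable_add_dim] assms(1)]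
  by simp

lemma (in product_sigma_finite) AE_PiM_insert_sections:
  assumes I: "finite I" "i \<notin> I" and AE: "AE z in PiM (insert i I) M. P z"
  shows "AE x in PiM I M. AE y in M i. P (x(i := y))"
proof -
  from AE obtain N where N: "{z \<in> space (PiM (insert i I) M). \<not> P z} \<subseteq> N"
    "emeasure (PiM (insert i I) M) N = 0" "N \<in> sets (PiM (insert i I) M)" by (rule AE_E)
  have N_meas: "(indicator N :: _ \<Rightarrow> ennreal) \<in> borel_measurable (PiM (insert i I) M)"
    by (rule borel_measurable_indicator[OF N(3)])
  have "(\<lambda>z. indicator N (case z of (x, y) \<Rightarrow> x(i := y)) :: ennreal) \<in> borel_measurable (PiM I M \<Otimes>\<^sub>M M i)"
    by (rule measurable_compose[OF measurable_add_dim N_meas])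
  from sigma_finite_measure.borel_measurable_nn_integral_fst[OF sigma_finite_measures this]
  have meas: "(\<lambda>x. \<integral>\<^sup>+ y. indicator N (x(i := y)) \<partial>M i) \<in> borel_measurable (PiM I M)"
    by (simp only: prod.case)
  have "(\<integral>\<^sup>+ x. \<integral>\<^sup>+ y. indicator N (x(i := y)) \<partial>M i \<partial>PiM I M) = (\<integral>\<^sup>+ z. indicator N z \<partial>PiM (insert i I) M)"
    by (rule product_nn_integral_insert[OF I N_meas, symmetric])
  also have "\<dots> = 0" using N(2) by (simp only: nn_integral_indicator[OF N(3)])
  finally have "AE x in PiM I M. (\<integral>\<^sup>+ y. indicator N (x(i := y)) \<partial>M i) = 0"
    by (rule iffD1[OF nn_integral_0_iff_AE[OF meas]])
  then show ?thesis
  proof (rule AE_mp[OF _ AE_I2[OF impI]])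
    fix x assume x: "x \<in> space (PiM I M)" and null: "(\<integral>\<^sup>+ y. indicator N (x(i := y)) \<partial>M i) = 0"
    have ind_meas: "(\<lambda>y. indicator N (x(i := y)) :: ennreal) \<in> borel_measurable (M i)"
      by (rule section_measurable[OF _ x]) (rule N_meas)
    have "AE y in M i. indicator N (x(i := y)) = (0::ennreal)"
      by (rule iffD1[OF nn_integral_0_iff_AE[OF ind_meas] null])
    then show "AE y in M i. P (x(i := y))"
    proof (rule AE_mp[OF _ AE_I2[OF impI]])
      fix y assume y: "y \<in> space (M i)" and ind: "indicator N (x(i := y)) = (0::ennreal)"
      have "x(i := y) \<in> space (PiM (insert i I) M)"
        using x y by (auto simp: space_PiM PiE_def extensional_def)
      moreover have "x(i := y) \<notin> N" using ind by (simp add: indicator_eq_0_iff)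
      ultimately show "P (x(i := y))" using N(1) by (metis (mono_tags, lifting) mem_Collect_eq subsetD)
    qed
  qed
qed

text \<open>The iterated norm for functions with values in \<open>[0, \<infinity>]\<close>. Borel measure may replace
  Lebesgue measure, as the integral of any function is the same for a measure and its
  completion; sections of Borel functions are Borel, which is not so for Lebesgue
  measurability.\<close>

primrec partial_norm :: "(nat \<Rightarrow> real) \<Rightarrow> ((nat \<Rightarrow> real) \<Rightarrow> ennreal) \<Rightarrow> nat \<Rightarrow> (nat \<Rightarrow> real) \<Rightarrow> ennreal" where
  "partial_norm p u 0 x = u x"
| "partial_norm p u (Suc k) x = Lp_norm lborel (p (Suc k)) (\<lambda>y. partial_norm p u k (x(Suc k := y)))"

lemma iterated_norm_eq_partial_norm: "iterated_norm p f k x = partial_norm p (\<lambda>x. ennreal (cmod (f x))) k x"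
  by (induction k arbitrary: x) (simp_all add: Lp_norm_def nn_integral_completion)

text \<open>After \<open>k\<close> integrations the remaining coordinates are \<open>k + 1, \<dots>, n\<close>.\<close>

abbreviation borel_n :: "nat \<Rightarrow> nat \<Rightarrow> (nat \<Rightarrow> real) measure" where
  "borel_n k n \<equiv> PiM {Suc k..n} (\<lambda>_. lborel)"

interpretation lborel_product: product_sigma_finite "\<lambda>_::nat. lborel :: real measure"
  by standard

lemma borel_n_insert: "k < n \<Longrightarrow> borel_n k n = PiM (insert (Suc k) {Suc (Suc k)..n}) (\<lambda>_. lborel)"
  by (simp add: atLeastAtMost_insertL)

lemma lebesgue_n_eq: "lebesgue_n n = completion (borel_n 0 n)"
  by (simp add: lebesgue_n_def)

text \<open>Almost every section of a null set is null, by Fubini's theorem. The theorem is applied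
  to a Borel null set containing the exceptional points, so \<open>u\<close> and \<open>v\<close> may be arbitrary. For \<open>k = n\<close>
  this says that the mixed norm depends only on the almost-everywhere class.\<close>

lemma partial_norm_mono_AE:
  assumes p: "\<And>i. i \<in> {1..n} \<Longrightarrow> 0 < p i" and uv: "AE x in borel_n 0 n. u x \<le> v x"
  shows "k \<le> n \<Longrightarrow> AE x in borel_n k n. partial_norm p u k x \<le> partial_norm p v k x"
proof (induction k)
  case 0 then show ?case using uv by simp
next
  case (Suc k)
  then have "AE z in borel_n k n. partial_norm p u k z \<le> partial_norm p v k z" and k: "k < n" by simp_all
  then have "AE z in PiM (insert (Suc k) {Suc (Suc k)..n}) (\<lambda>_. lborel). partial_norm p u k z \<le> partial_norm p v k z"
    unfolding borel_n_insert[OF k] by simp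
  then have "AE x in borel_n (Suc k) n. AE y in lborel. partial_norm p u k (x(Suc k := y)) \<le> partial_norm p v k (x(Suc k := y))"
    by (rule lborel_product.AE_PiM_insert_sections[rotated 2]) auto
  then show ?case
    by (rule eventually_mono) (use p[of "Suc k"] Suc.prems in \<open>auto intro!: Lp_norm_mono_AE\<close>)
qed

lemma section_of_borel_n:
  assumes "k < n" "u \<in> borel_measurable (borel_n k n)" "x \<in> space (borel_n (Suc k) n)"
  shows "(\<lambda>y. u (x(Suc k := y))) \<in> borel_measurable lborel"
  using assms(2) unfolding borel_n_insert[OF assms(1)] by (rule section_measurable) (rule assms(3))

lemma fun_upd_in_borel_n:
  assumes "k < n" "x \<in> space (borel_n (Suc k) n)"
  shows "x(Suc k := y) \<in> space (borel_n k n)"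
  using assms(2) unfolding borel_n_insert[OF assms(1)] by (auto simp: space_PiM PiE_def extensional_def)

lemma partial_norm_measurable:
  assumes u: "u \<in> borel_measurable (borel_n 0 n)"
  shows "k \<le> n \<Longrightarrow> partial_norm p u k \<in> borel_measurable (borel_n k n)"
proof (induction k)
  case 0
  have "partial_norm p u 0 = u" by (rule ext) simp
  with u show ?case by simp
next
  case (Suc k)
  then have "partial_norm p u k \<in> borel_measurable (borel_n k n)" and k: "k < n" by simp_all
  then have [measurable]: "partial_norm p u k \<in> borel_measurable (PiM (insert (Suc k) {Suc (Suc k)..n}) (\<lambda>_. lborel))"
    unfolding borel_n_insert[OF k] by simp
  have "(\<lambda>z. partial_norm p u k ((case z of (x, y) \<Rightarrow> x(Suc k := y))))
      \<in> borel_measurable (borel_n (Suc k) n \<Otimes>\<^sub>M lborel)"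
    by (rule measurable_compose[OF measurable_add_dim]) measurable
  then have [measurable]: "(\<lambda>(x, y). partial_norm p u k (x(Suc k := y))) \<in> borel_measurable (borel_n (Suc k) n \<Otimes>\<^sub>M lborel)"
    by (simp add: case_prod_beta)
  have "(\<lambda>x. Lp_norm lborel (p (Suc k)) (\<lambda>y. partial_norm p u k (x(Suc k := y)))) \<in> borel_measurable (borel_n (Suc k) n)"
    unfolding Lp_norm_def by measurable
  moreover have "partial_norm p u (Suc k) = (\<lambda>x. Lp_norm lborel (p (Suc k)) (\<lambda>y. partial_norm p u k (x(Suc k := y))))"
    by (rule ext) simp
  ultimately show ?case by simp
qed

lemma partial_norm_section_measurable:
  assumes "u \<in> borel_measurable (borel_n 0 n)" "Suc k \<le> n" "x \<in> space (borel_n (Suc k) n)"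
  shows "(\<lambda>y. partial_norm p u k (x(Suc k := y))) \<in> borel_measurable lborel"
  using assms by (intro section_of_borel_n[where n = n] partial_norm_measurable) auto

lemma partial_norm_mono:
  assumes p: "\<And>i. i \<in> {1..n} \<Longrightarrow> 0 < p i" and uv: "\<And>x. u x \<le> v x"
  shows "k \<le> n \<Longrightarrow> partial_norm p u k x \<le> partial_norm p v k x"
  by (induction k arbitrary: x) (use p uv in \<open>auto intro!: Lp_norm_mono\<close>)

lemma partial_norm_cmult:
  assumes p: "\<And>i. i \<in> {1..n} \<Longrightarrow> 0 < p i" and u: "u \<in> borel_measurable (borel_n 0 n)"
  shows "k \<le> n \<Longrightarrow> x \<in> space (borel_n k n) \<Longrightarrow> partial_norm p (\<lambda>x. c * u x) k x = c * partial_norm p u k x"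
proof (induction k arbitrary: x)
  case (Suc k)
  have "partial_norm p (\<lambda>x. c * u x) (Suc k) x = Lp_norm lborel (p (Suc k)) (\<lambda>y. c * partial_norm p u k (x(Suc k := y)))"
    using Suc by (simp add: fun_upd_in_borel_n)
  also have "\<dots> = c * partial_norm p u (Suc k) x"
    unfolding partial_norm.simps using p[of "Suc k"] Suc.prems
    by (intro Lp_norm_cmult partial_norm_section_measurable[OF u]) auto
  finally show ?case .
qed simp

lemma partial_norm_add:
  assumes p: "\<And>i. i \<in> {1..n} \<Longrightarrow> 1 < p i"
    and u: "u \<in> borel_measurable (borel_n 0 n)" and v: "v \<in> borel_measurable (borel_n 0 n)"
  shows "k \<le> n \<Longrightarrow> x \<in> space (borel_n k n) \<Longrightarrow> partial_norm p (\<lambda>x. u x + v x) k x \<le> partial_norm p u k x + partial_norm p v k x"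
proof (induction k arbitrary: x)
  case (Suc k)
  have pk: "1 < p (Suc k)" using p[of "Suc k"] Suc.prems by simp
  have "partial_norm p (\<lambda>x. u x + v x) (Suc k) x
      \<le> Lp_norm lborel (p (Suc k)) (\<lambda>y. partial_norm p u k (x(Suc k := y)) + partial_norm p v k (x(Suc k := y)))"
    unfolding partial_norm.simps using pk Suc by (intro Lp_norm_mono) (auto simp: fun_upd_in_borel_n)
  also have "\<dots> \<le> partial_norm p u (Suc k) x + partial_norm p v (Suc k) x"
    unfolding partial_norm.simps using Suc.prems
    by (intro minkowski pk partial_norm_section_measurable[OF u] partial_norm_section_measurable[OF v])
  finally show ?case .
qed simp

lemma partial_norm_suminf:
  assumes p: "\<And>i. i \<in> {1..n} \<Longrightarrow> 1 < p i"
    and u: "\<And>j. u j \<in> borel_measurable (borel_n 0 n)"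
  shows "k \<le> n \<Longrightarrow> x \<in> space (borel_n k n) \<Longrightarrow> partial_norm p (\<lambda>x. \<Sum>j. u j x) k x \<le> (\<Sum>j::nat. partial_norm p (u j) k x)"
proof (induction k arbitrary: x)
  case (Suc k)
  have pk: "1 < p (Suc k)" using p[of "Suc k"] Suc.prems by simp
  have "partial_norm p (\<lambda>x. \<Sum>j. u j x) (Suc k) x
      \<le> Lp_norm lborel (p (Suc k)) (\<lambda>y. \<Sum>j. partial_norm p (u j) k (x(Suc k := y)))"
    unfolding partial_norm.simps using pk Suc by (intro Lp_norm_mono) (auto simp: fun_upd_in_borel_n)
  also have "\<dots> \<le> (\<Sum>j. partial_norm p (u j) (Suc k) x)"
    unfolding partial_norm.simps using Suc.prems
    by (intro minkowski_suminf pk partial_norm_section_measurable[OF u])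
  finally show ?case .
qed simp

lemma space_borel_n_n: "space (borel_n n n) = {\<lambda>_. undefined}"
  by (simp add: PiM_empty)

lemma AE_borel_n_n: "(AE x in borel_n n n. P x) \<longleftrightarrow> P (\<lambda>_. undefined)"
proof -
  have "borel_n n n = count_space {\<lambda>_. undefined}" by (simp add: PiM_empty)
  then show ?thesis by (simp only: AE_count_space) simp
qed

text \<open>Descending from \<open>k = n\<close> to \<open>k = 0\<close>: where a norm in one coordinate vanishes, the
  integrand vanishes for almost all values of that coordinate, and Fubini's theorem turns this
  into a statement about almost all points.\<close>

lemma partial_norm_eq_0:
  assumes u: "u \<in> borel_measurable (borel_n 0 n)" and z: "partial_norm p u n (\<lambda>_. undefined) = 0"
  shows "AE x in borel_n 0 n. u x = 0"
proof -
  have "AE x in borel_n 0 n. partial_norm p u 0 x = 0"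
    using le0[of n]
  proof (induction rule: inc_induct)
    case base
    then show ?case using z unfolding AE_borel_n_n .
  next
    case (step k)
    then have k: "k < n" by simp
    have "AE x in borel_n (Suc k) n. (\<integral>\<^sup>+ y. partial_norm p u k (x(Suc k := y)) \<partial>lborel) = 0"
      using step.IH
    proof (rule AE_mp[OF _ AE_I2[OF impI]])
      fix x assume x: "x \<in> space (borel_n (Suc k) n)" and "partial_norm p u (Suc k) x = 0"
      then show "(\<integral>\<^sup>+ y. partial_norm p u k (x(Suc k := y)) \<partial>lborel) = 0"
        using Lp_norm_eq_0_iff[OF partial_norm_section_measurable[OF u _ x]] k
          nn_integral_0_iff_AE[OF partial_norm_section_measurable[OF u _ x]] by simp
    qed
    then have "(\<integral>\<^sup>+ x. \<integral>\<^sup>+ y. partial_norm p u k (x(Suc k := y)) \<partial>lborel \<partial>borel_n (Suc k) n) = (\<integral>\<^sup>+ x. 0 \<partial>borel_n (Suc k) n)"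
      by (rule nn_integral_cong_AE)
    moreover have meas: "partial_norm p u k \<in> borel_measurable (PiM (insert (Suc k) {Suc (Suc k)..n}) (\<lambda>_. lborel))"
      using partial_norm_measurable[OF u, of k p] k unfolding borel_n_insert[OF k] by simp
    ultimately have "(\<integral>\<^sup>+ z. partial_norm p u k z \<partial>PiM (insert (Suc k) {Suc (Suc k)..n}) (\<lambda>_. lborel)) = 0"
      by (subst lborel_product.product_nn_integral_insert[OF _ _ meas]) auto
    then show ?case unfolding borel_n_insert[OF k] using nn_integral_0_iff_AE[OF meas] by simp
  qed
  then show ?thesis by simp
qed

text \<open>All quadruples of norms that occur after \<open>k\<close> integrations, at every point of the
  remaining coordinates; the constants in the convexity inequality have to be uniform in both
  the functions and the point.\<close>

definition section_quadruples :: "(nat \<Rightarrow> real) \<Rightarrow> nat \<Rightarrow> nat \<Rightarrow> (ennreal \<times> ennreal \<times> ennreal \<times> ennreal) set" where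
  "section_quadruples p n k = {(partial_norm p (\<lambda>x. ennreal (cmod (f x))) k x, partial_norm p (\<lambda>x. ennreal (cmod (g x))) k x,
      partial_norm p (\<lambda>x. ennreal (cmod ((f x + g x) / 2))) k x, partial_norm p (\<lambda>x. ennreal (cmod (f x - g x))) k x) | f g x.
      f \<in> borel_measurable (borel_n 0 n) \<and> g \<in> borel_measurable (borel_n 0 n) \<and> x \<in> space (borel_n k n)}"

lemma section_quadruples_triangle:
  assumes p: "\<And>i. i \<in> {1..n} \<Longrightarrow> 1 < p i" and k: "k \<le> n" and S: "(a, b, m, d) \<in> section_quadruples p n k"
  shows "2 * m \<le> a + b \<and> d \<le> a + b"
proof -
  obtain f g x where fg: "a = partial_norm p (\<lambda>x. ennreal (cmod (f x))) k x" "b = partial_norm p (\<lambda>x. ennreal (cmod (g x))) k x"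
     "m = partial_norm p (\<lambda>x. ennreal (cmod ((f x + g x) / 2))) k x" "d = partial_norm p (\<lambda>x. ennreal (cmod (f x - g x))) k x"
     and [measurable]: "f \<in> borel_measurable (borel_n 0 n)" "g \<in> borel_measurable (borel_n 0 n)" and x: "x \<in> space (borel_n k n)"
    using S unfolding section_quadruples_def by blast
  have p0: "0 < p i" if "i \<in> {1..n}" for i using p[OF that] by simp
  have sum: "partial_norm p (\<lambda>x. ennreal (cmod (f x)) + ennreal (cmod (g x))) k x \<le> a + b"
    unfolding fg by (intro partial_norm_add[OF p _ _ k x]) auto
  have "2 * m = partial_norm p (\<lambda>x. 2 * ennreal (cmod ((f x + g x) / 2))) k x"
    unfolding fg by (rule partial_norm_cmult[OF p0 _ k x, symmetric]) auto
  also have "\<dots> \<le> partial_norm p (\<lambda>x. ennreal (cmod (f x)) + ennreal (cmod (g x))) k x"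
  proof (rule partial_norm_mono[OF p0 _ k])
    fix x
    have "2 * ennreal (cmod ((f x + g x) / 2)) = ennreal (2 * cmod ((f x + g x) / 2))" by (subst ennreal_mult) auto
    also have "2 * cmod ((f x + g x) / 2) = cmod (f x + g x)" by (simp add: norm_divide)
    also have "ennreal \<dots> \<le> ennreal (cmod (f x)) + ennreal (cmod (g x))"
      by (auto simp flip: ennreal_plus intro!: ennreal_leI norm_triangle_ineq)
    finally show "2 * ennreal (cmod ((f x + g x) / 2)) \<le> ennreal (cmod (f x)) + ennreal (cmod (g x))" .
  qed auto
  finally have "2 * m \<le> a + b" using sum by (rule order_trans)
  moreover have "d \<le> partial_norm p (\<lambda>x. ennreal (cmod (f x)) + ennreal (cmod (g x))) k x"
    unfolding fg by (rule partial_norm_mono[OF p0 _ k]) (auto simp flip: ennreal_plus intro!: ennreal_leI norm_triangle_ineq4)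
  then have "d \<le> a + b" using sum by (rule order_trans)
  ultimately show ?thesis ..
qed

lemma power_convex_subset: "S \<subseteq> T \<Longrightarrow> power_convex q T \<Longrightarrow> power_convex q S"
  unfolding power_convex_def by (meson subsetD)

text \<open>Each step first changes the exponent to \<open>p (k + 1)\<close>, integrates over that coordinate,
  and then changes to the exponent requested.\<close>

lemma power_convex_sections:
  assumes p: "\<And>i. i \<in> {1..n} \<Longrightarrow> 1 < p i"
  shows "k \<le> n \<Longrightarrow> 1 < q \<Longrightarrow> power_convex q (section_quadruples p n k)"
proof (induction k arbitrary: q)
  case 0
  show ?case
    by (rule power_convex_subset[OF _ power_convex_scalar[OF 0(2)]]) (auto simp: section_quadruples_def)
next
  case (Suc k)
  have pk: "1 < p (Suc k)" using p[of "Suc k"] Suc.prems by simp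
  have IH: "power_convex (p (Suc k)) (section_quadruples p n k)" using Suc pk by simp
  have "power_convex (p (Suc k)) (section_quadruples p n (Suc k))"
    unfolding power_convex_def
  proof (intro allI impI)
    fix e :: real assume "0 < e"
    with IH obtain C where C: "0 < C" and "\<forall>(a, b, m, d)\<in>section_quadruples p n k. convexity_ineq (p (Suc k)) e C a b m d"
      unfolding power_convex_def by blast
    then have ineq: "convexity_ineq (p (Suc k)) e C a b m d" if "(a, b, m, d) \<in> section_quadruples p n k" for a b m d
      using that by fast
    have "convexity_ineq (p (Suc k)) e C a b m d" if "(a, b, m, d) \<in> section_quadruples p n (Suc k)" for a b m d
    proof -
      obtain f g x where fg: "a = partial_norm p (\<lambda>x. ennreal (cmod (f x))) (Suc k) x" "b = partial_norm p (\<lambda>x. ennreal (cmod (g x))) (Suc k) x"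
         "m = partial_norm p (\<lambda>x. ennreal (cmod ((f x + g x) / 2))) (Suc k) x" "d = partial_norm p (\<lambda>x. ennreal (cmod (f x - g x))) (Suc k) x"
         and meas [measurable]: "f \<in> borel_measurable (borel_n 0 n)" "g \<in> borel_measurable (borel_n 0 n)"
         and x: "x \<in> space (borel_n (Suc k) n)"
        using \<open>(a, b, m, d) \<in> section_quadruples p n (Suc k)\<close> unfolding section_quadruples_def by blast
      have section_meas: "(\<lambda>x. ennreal (cmod (f x))) \<in> borel_measurable (borel_n 0 n)"
        "(\<lambda>x. ennreal (cmod (g x))) \<in> borel_measurable (borel_n 0 n)"
        "(\<lambda>x. ennreal (cmod ((f x + g x) / 2))) \<in> borel_measurable (borel_n 0 n)"
        "(\<lambda>x. ennreal (cmod (f x - g x))) \<in> borel_measurable (borel_n 0 n)"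
        by measurable
      show ?thesis unfolding fg partial_norm.simps
      proof (rule convexity_ineq_Lp_norm)
        fix y :: real
        have "x(Suc k := y) \<in> space (borel_n k n)" using Suc.prems x by (intro fun_upd_in_borel_n) auto
        then show "convexity_ineq (p (Suc k)) e C (partial_norm p (\<lambda>x. ennreal (cmod (f x))) k (x(Suc k := y)))
            (partial_norm p (\<lambda>x. ennreal (cmod (g x))) k (x(Suc k := y)))
            (partial_norm p (\<lambda>x. ennreal (cmod ((f x + g x) / 2))) k (x(Suc k := y)))
            (partial_norm p (\<lambda>x. ennreal (cmod (f x - g x))) k (x(Suc k := y)))"
          using meas by (intro ineq) (unfold section_quadruples_def, blast)
        show "0 < p (Suc k)" using pk by simp
      qed (intro partial_norm_section_measurable[OF _ Suc.prems(1) x] section_meas)+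
    qed
    then show "\<exists>C>0. \<forall>(a, b, m, d)\<in>section_quadruples p n (Suc k). convexity_ineq (p (Suc k)) e C a b m d"
      using C by blast
  qed
  then show ?case
    using pk Suc.prems section_quadruples_triangle[OF p Suc.prems(1)]
    by (intro power_convex_change_exponent[of "p (Suc k)" q]) auto
qed

lemma completion_ex_borel_measurable_complex:
  fixes f :: "'a \<Rightarrow> complex"
  assumes [measurable]: "f \<in> borel_measurable (completion M)"
  obtains g where "g \<in> borel_measurable M" "AE x in M. f x = g x"
proof -
  have "(\<lambda>x. Re (f x)) \<in> borel_measurable (completion M)" "(\<lambda>x. Im (f x)) \<in> borel_measurable (completion M)"
    by measurable
  from this[THEN completion_ex_borel_measurable_real] obtain a b
    where [measurable]: "a \<in> borel_measurable M" "b \<in> borel_measurable M"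
      and ab: "AE x in M. Re (f x) = a x" "AE x in M. Im (f x) = b x" by blast
  show thesis
  proof (rule that[of "\<lambda>x. complex_of_real (a x) + \<i> * complex_of_real (b x)"])
    show "(\<lambda>x. complex_of_real (a x) + \<i> * complex_of_real (b x)) \<in> borel_measurable M"
      by measurable
    show "AE x in M. f x = complex_of_real (a x) + \<i> * complex_of_real (b x)" using ab by eventually_elim (simp add: complex_eq_iff)
  qed
qed

locale mixed_norm =
  fixes n :: nat and p :: "nat \<Rightarrow> real"
  assumes p: "\<And>i. i \<in> {1..n} \<Longrightarrow> 1 < p i"
begin

abbreviation mixed_norm_of :: "((nat \<Rightarrow> real) \<Rightarrow> ennreal) \<Rightarrow> ennreal" where
  "mixed_norm_of u \<equiv> partial_norm p u n (\<lambda>_. undefined)"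

lemma p_pos: "i \<in> {1..n} \<Longrightarrow> 0 < p i"
  using p[of i] by simp

lemma undefined_in_space: "(\<lambda>_. undefined) \<in> space (borel_n n n)"
  by (simp add: space_borel_n_n)

lemma mixed_norm_of_mono: "AE x in lebesgue_n n. u x \<le> v x \<Longrightarrow> mixed_norm_of u \<le> mixed_norm_of v"
  using partial_norm_mono_AE[where p = p and n = n and u = u and v = v and k = n, OF p_pos] unfolding lebesgue_n_eq AE_completion_iff AE_borel_n_n by simp

lemma mixed_norm_of_cong: "AE x in lebesgue_n n. u x = v x \<Longrightarrow> mixed_norm_of u = mixed_norm_of v"
  by (rule antisym; rule mixed_norm_of_mono; erule eventually_mono) simp_all

lemma borel_representative:
  assumes "u \<in> borel_measurable (lebesgue_n n)"
  obtains u' where "u' \<in> borel_measurable (borel_n 0 n)" "AE x in lebesgue_n n. u x = (u' x :: ennreal)"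
proof -
  from completion_ex_borel_measurable[OF assms[unfolded lebesgue_n_eq]]
  obtain u' where "u' \<in> borel_measurable (borel_n 0 n)" "AE x in borel_n 0 n. u x = u' x" by blast
  then show thesis by (intro that[of u']) (simp_all only: lebesgue_n_eq AE_completion_iff)
qed

lemma borel_representative_complex:
  assumes "f \<in> borel_measurable (lebesgue_n n)"
  obtains f' where "f' \<in> borel_measurable (borel_n 0 n)" "AE x in lebesgue_n n. f x = (f' x :: complex)"
proof -
  obtain f' where "f' \<in> borel_measurable (borel_n 0 n)" "AE x in borel_n 0 n. f x = f' x"
    by (rule completion_ex_borel_measurable_complex[OF assms[unfolded lebesgue_n_eq]])
  then show thesis by (intro that[of f']) (simp_all only: lebesgue_n_eq AE_completion_iff)
qed

lemma mixed_norm_of_cmult: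
  assumes "u \<in> borel_measurable (lebesgue_n n)"
  shows "mixed_norm_of (\<lambda>x. c * u x) = c * mixed_norm_of u"
proof -
  obtain u' where u': "u' \<in> borel_measurable (borel_n 0 n)" "AE x in lebesgue_n n. u x = u' x"
    using assms by (rule borel_representative)
  have "mixed_norm_of (\<lambda>x. c * u x) = mixed_norm_of (\<lambda>x. c * u' x)"
    by (rule mixed_norm_of_cong, rule eventually_mono[OF u'(2)]) simp
  also have "\<dots> = c * mixed_norm_of u'" by (rule partial_norm_cmult[OF p_pos u'(1) order_refl undefined_in_space])
  also have "mixed_norm_of u' = mixed_norm_of u" by (rule mixed_norm_of_cong[OF u'(2), symmetric])
  finally show ?thesis .
qed

lemma mixed_norm_of_suminf:
  assumes "\<And>j. u j \<in> borel_measurable (lebesgue_n n)"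
  shows "mixed_norm_of (\<lambda>x. \<Sum>j. u j x) \<le> (\<Sum>j::nat. mixed_norm_of (u j))"
proof -
  have "\<forall>j. \<exists>u'. u' \<in> borel_measurable (borel_n 0 n) \<and> (AE x in lebesgue_n n. u j x = u' x)"
    by (rule allI, rule borel_representative[OF assms]) (rule exI, rule conjI)
  from choice[OF this] obtain u' where
    "\<forall>j. u' j \<in> borel_measurable (borel_n 0 n) \<and> (AE x in lebesgue_n n. u j x = u' j x)" ..
  then have u': "u' j \<in> borel_measurable (borel_n 0 n)" "AE x in lebesgue_n n. u j x = u' j x" for j
    by simp_all
  have "AE x in lebesgue_n n. \<forall>j. u j x = u' j x" using u'(2) by (simp add: AE_all_countable)
  then have "mixed_norm_of (\<lambda>x. \<Sum>j. u j x) = mixed_norm_of (\<lambda>x. \<Sum>j. u' j x)"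
    by (intro mixed_norm_of_cong) (erule eventually_mono, simp)
  also have "\<dots> \<le> (\<Sum>j. mixed_norm_of (u' j))" by (rule partial_norm_suminf[OF p u'(1) order_refl undefined_in_space])
  also have "\<dots> = (\<Sum>j. mixed_norm_of (u j))" by (intro suminf_cong mixed_norm_of_cong[OF u'(2), symmetric])
  finally show ?thesis .
qed

lemma mixed_norm_of_eq_0:
  assumes "u \<in> borel_measurable (lebesgue_n n)" "mixed_norm_of u = 0"
  shows "AE x in lebesgue_n n. u x = 0"
proof -
  obtain u' where u': "u' \<in> borel_measurable (borel_n 0 n)" "AE x in lebesgue_n n. u x = u' x"
    using assms(1) by (rule borel_representative)
  have "mixed_norm_of u' = 0" using assms(2) mixed_norm_of_cong[OF u'(2)] by simp
  then have "AE x in lebesgue_n n. u' x = 0"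
    unfolding lebesgue_n_eq AE_completion_iff by (rule partial_norm_eq_0[OF u'(1)])
  with u'(2) show ?thesis by eventually_elim simp
qed

text \<open>Lebesgue measurable functions are replaced by Borel representatives, for which the
  inequality is known.\<close>

lemma mixed_norm_of_convexity:
  assumes q: "1 < q" and e: "0 < e"
  shows "\<exists>C>0. \<forall>f g. f \<in> borel_measurable (lebesgue_n n) \<longrightarrow> g \<in> borel_measurable (lebesgue_n n) \<longrightarrow>
    convexity_ineq q e C (mixed_norm_of (\<lambda>x. ennreal (cmod (f x)))) (mixed_norm_of (\<lambda>x. ennreal (cmod (g x))))
      (mixed_norm_of (\<lambda>x. ennreal (cmod ((f x + g x) / 2)))) (mixed_norm_of (\<lambda>x. ennreal (cmod (f x - g x))))"
proof -
  have "power_convex q (section_quadruples p n n)" by (rule power_convex_sections[OF p order_refl q])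
  with e obtain C where C: "0 < C" and "\<forall>(a, b, m, d)\<in>section_quadruples p n n. convexity_ineq q e C a b m d"
    unfolding power_convex_def by blast
  then have ineq: "convexity_ineq q e C a b m d" if "(a, b, m, d) \<in> section_quadruples p n n" for a b m d
    using that by fast
  have "convexity_ineq q e C (mixed_norm_of (\<lambda>x. ennreal (cmod (f x)))) (mixed_norm_of (\<lambda>x. ennreal (cmod (g x))))
      (mixed_norm_of (\<lambda>x. ennreal (cmod ((f x + g x) / 2)))) (mixed_norm_of (\<lambda>x. ennreal (cmod (f x - g x))))"
    if f: "f \<in> borel_measurable (lebesgue_n n)" and g: "g \<in> borel_measurable (lebesgue_n n)" for f g
  proof -
    obtain f' where f': "f' \<in> borel_measurable (borel_n 0 n)" "AE x in lebesgue_n n. f x = f' x"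
      using f by (rule borel_representative_complex)
    obtain g' where g': "g' \<in> borel_measurable (borel_n 0 n)" "AE x in lebesgue_n n. g x = g' x"
      using g by (rule borel_representative_complex)
    have eq: "mixed_norm_of (\<lambda>x. h (f x) (g x)) = mixed_norm_of (\<lambda>x. h (f' x) (g' x))" for h
    proof (rule mixed_norm_of_cong)
      show "AE x in lebesgue_n n. h (f x) (g x) = h (f' x) (g' x)"
        using f'(2) g'(2) by eventually_elim simp
    qed
    have "(mixed_norm_of (\<lambda>x. ennreal (cmod (f' x))), mixed_norm_of (\<lambda>x. ennreal (cmod (g' x))),
        mixed_norm_of (\<lambda>x. ennreal (cmod ((f' x + g' x) / 2))), mixed_norm_of (\<lambda>x. ennreal (cmod (f' x - g' x))))
      \<in> section_quadruples p n n"
      using f'(1) g'(1) undefined_in_space unfolding section_quadruples_def by blast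
    then show ?thesis
      unfolding eq[of "\<lambda>z w. ennreal (cmod z)"] eq[of "\<lambda>z w. ennreal (cmod w)"]
        eq[of "\<lambda>z w. ennreal (cmod ((z + w) / 2))"] eq[of "\<lambda>z w. ennreal (cmod (z - w))"]
      by (rule ineq)
  qed
  with C show ?thesis by (intro exI[of _ C] conjI allI impI)
qed

end

section \<open>Mixed Bourgain-Morrey spaces\<close>

lemma infsum_eq_nn_integral:
  fixes f :: "'a \<Rightarrow> ennreal"
  assumes "countable A"
  shows "(\<Sum>\<^sub>\<infinity>x\<in>A. f x) = (\<integral>\<^sup>+ x. f x \<partial>count_space A)"
proof (cases "finite A")
  case True
  then show ?thesis by (simp add: nn_integral_count_space_finite)
next
  case False
  define e where "e = from_nat_into A"
  have e: "bij_betw e UNIV A" unfolding e_def using assms False by (rule bij_betw_from_nat_into)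
  have "(\<Sum>\<^sub>\<infinity>x\<in>A. f x) = (\<Sum>\<^sub>\<infinity>j. f (e j))" by (rule infsum_reindex_bij_betw[OF e, symmetric])
  also have "\<dots> = (\<Sum>j. f (e j))"
    by (rule sums_unique[OF has_sum_imp_sums[OF has_sum_infsum[OF nonneg_summable_on_complete]]]) simp
  also have "\<dots> = (\<integral>\<^sup>+ j. f (e j) \<partial>count_space UNIV)" by (simp add: nn_integral_count_space_nat)
  also have "\<dots> = (\<integral>\<^sup>+ x. f x \<partial>count_space A)" by (rule nn_integral_bij_count_space[OF e])
  finally show ?thesis .
qed

lemma dyadic_cube_borel: "dyadic_cube n j m \<in> sets (borel_n 0 n)"
  unfolding dyadic_cube_def One_nat_def by (rule sets_PiM_I_finite) simp_all

lemma measure_dyadic_cube_pos: "0 < measure (lebesgue_n n) (dyadic_cube n j m)"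
proof -
  define l where "l = (2::real) powi (- j)"
  have l: "0 < l" by (simp add: l_def)
  have "emeasure (borel_n 0 n) (dyadic_cube n j m)
      = (\<Prod>i\<in>{Suc 0..n}. emeasure lborel {l * real_of_int (m i) ..< l * (real_of_int (m i) + 1)})"
    unfolding dyadic_cube_def One_nat_def l_def by (rule lborel_product.emeasure_PiM) simp_all
  also have "\<dots> = (\<Prod>i\<in>{Suc 0..n}. ennreal l)"
    using l by (intro prod.cong refl) (simp add: algebra_simps)
  also have "\<dots> = ennreal (l ^ n)" using l by (simp add: ennreal_power)
  finally have "measure (borel_n 0 n) (dyadic_cube n j m) = l ^ n"
    using l by (simp add: measure_def)
  then show ?thesis using l by (simp add: lebesgue_n_eq dyadic_cube_borel)
qed

lemma countable_dyadic_cubes: "countable (dyadic_cubes n)"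
proof -
  let ?I = "PiE {1..n} (\<lambda>_. UNIV :: int set)"
  have "dyadic_cubes n \<subseteq> (\<Union>j. dyadic_cube n j ` ?I)"
  proof
    fix Q assume "Q \<in> dyadic_cubes n"
    then obtain j m where "Q = dyadic_cube n j m" unfolding dyadic_cubes_def by blast
    also have "\<dots> = dyadic_cube n j (restrict m {1..n})"
      unfolding dyadic_cube_def by (intro PiE_cong) simp
    finally have "Q \<in> dyadic_cube n j ` ?I" by (intro image_eqI[where x = "restrict m {1..n}"]) simp_all
    then show "Q \<in> (\<Union>j. dyadic_cube n j ` ?I)" by (rule UN_I[OF UNIV_I])
  qed
  moreover have "countable (\<Union>j. dyadic_cube n j ` ?I)"
    by (intro countable_UN countable_image countable_PiE) simp_all
  ultimately show ?thesis by (rule countable_subset)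
qed

context mixed_norm
begin

text \<open>Powers of the volume enter the Bourgain-Morrey norm as weights of a sum over cubes, so
  the norm is an \<open>L\<^sup>r\<close> norm over a measure on the set of cubes.\<close>

definition bm_measure :: "real \<Rightarrow> real \<Rightarrow> (nat \<Rightarrow> real) set measure" where
  "bm_measure t r = density (count_space (dyadic_cubes n))
     (\<lambda>Q. ennreal (measure (lebesgue_n n) Q powr (r / t - r / real n * (\<Sum>i=1..n. 1 / p i))))"

definition bm_norm :: "real \<Rightarrow> real \<Rightarrow> ((nat \<Rightarrow> real) \<Rightarrow> ennreal) \<Rightarrow> ennreal" where
  "bm_norm t r u = Lp_norm (bm_measure t r) r (\<lambda>Q. mixed_norm_of (\<lambda>x. u x * indicator Q x))"

lemma bm_measurable [measurable, simp]: "h \<in> borel_measurable (bm_measure t r)"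
  by (simp add: bm_measure_def measurable_def)

lemma space_bm_measure [simp]: "space (bm_measure t r) = dyadic_cubes n"
  by (simp add: bm_measure_def)

lemma cube_in_sets: "Q \<in> dyadic_cubes n \<Longrightarrow> Q \<in> sets (lebesgue_n n)"
  by (auto simp: dyadic_cubes_def lebesgue_n_eq intro!: sets_completionI_sets dyadic_cube_borel)

lemma cutoff_measurable:
  assumes "Q \<in> dyadic_cubes n" "u \<in> borel_measurable (lebesgue_n n)"
  shows "(\<lambda>x. u x * indicator Q x :: ennreal) \<in> borel_measurable (lebesgue_n n)"
  using assms by (intro borel_measurable_times_ennreal borel_measurable_indicator cube_in_sets)

text \<open>Every property passes from the mixed norm on each cube to the \<open>L\<^sup>r\<close> norm over the
  cubes. For definiteness, the countably many cubes of side one cover the space and have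
  positive weight.\<close>

lemma function_norm_bm:
  assumes r: "1 < r"
  shows "function_norm (lebesgue_n n) (bm_norm t r)"
proof
  fix u v :: "(nat \<Rightarrow> real) \<Rightarrow> ennreal"
  assume "AE x in lebesgue_n n. u x \<le> v x"
  then have "AE x in lebesgue_n n. u x * indicator Q x \<le> v x * indicator Q x" for Q
    by (rule eventually_mono) (rule mult_right_mono, auto)
  then show "bm_norm t r u \<le> bm_norm t r v"
    unfolding bm_norm_def using r by (intro Lp_norm_mono mixed_norm_of_mono) simp_all
next
  fix c :: real and u :: "(nat \<Rightarrow> real) \<Rightarrow> ennreal"
  assume u: "u \<in> borel_measurable (lebesgue_n n)"
  have "bm_norm t r (\<lambda>x. ennreal c * u x) = Lp_norm (bm_measure t r) r (\<lambda>Q. ennreal c * mixed_norm_of (\<lambda>x. u x * indicator Q x))"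
    unfolding bm_norm_def
  proof (rule Lp_norm_cong_AE, rule AE_I2)
    fix Q assume "Q \<in> space (bm_measure t r)"
    then have "(\<lambda>x. u x * indicator Q x) \<in> borel_measurable (lebesgue_n n)"
      by (intro cutoff_measurable u) simp
    from mixed_norm_of_cmult[OF this, of "ennreal c"]
    show "mixed_norm_of (\<lambda>x. ennreal c * u x * indicator Q x) = ennreal c * mixed_norm_of (\<lambda>x. u x * indicator Q x)"
      by (simp only: mult.assoc)
  qed
  also have "\<dots> = ennreal c * bm_norm t r u"
    unfolding bm_norm_def using r by (intro Lp_norm_cmult) simp_all
  finally show "bm_norm t r (\<lambda>x. ennreal c * u x) = ennreal c * bm_norm t r u" .
next
  fix u :: "nat \<Rightarrow> (nat \<Rightarrow> real) \<Rightarrow> ennreal"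
  assume u: "\<And>j. u j \<in> borel_measurable (lebesgue_n n)"
  have "bm_norm t r (\<lambda>x. \<Sum>j. u j x) \<le> Lp_norm (bm_measure t r) r (\<lambda>Q. \<Sum>j. mixed_norm_of (\<lambda>x. u j x * indicator Q x))"
    unfolding bm_norm_def
  proof (rule Lp_norm_mono)
    fix Q assume "Q \<in> space (bm_measure t r)"
    then have "(\<lambda>x. u j x * indicator Q x) \<in> borel_measurable (lebesgue_n n)" for j
      by (intro cutoff_measurable u) simp
    from mixed_norm_of_suminf[OF this]
    show "mixed_norm_of (\<lambda>x. (\<Sum>j. u j x) * indicator Q x) \<le> (\<Sum>j. mixed_norm_of (\<lambda>x. u j x * indicator Q x))"
      by (simp only: ennreal_suminf_multc)
  qed (use r in simp)
  also have "\<dots> \<le> (\<Sum>j. bm_norm t r (u j))"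
    unfolding bm_norm_def using r by (intro minkowski_suminf) simp_all
  finally show "bm_norm t r (\<lambda>x. \<Sum>j. u j x) \<le> (\<Sum>j. bm_norm t r (u j))" .
next
  fix u :: "(nat \<Rightarrow> real) \<Rightarrow> ennreal"
  assume u: "u \<in> borel_measurable (lebesgue_n n)" and "bm_norm t r u = 0"
  then have "AE Q in bm_measure t r. mixed_norm_of (\<lambda>x. u x * indicator Q x) = 0"
    unfolding bm_norm_def by (simp only: Lp_norm_eq_0_iff bm_measurable)
  then have null: "\<forall>Q\<in>dyadic_cubes n. 0 < measure (lebesgue_n n) Q \<longrightarrow> mixed_norm_of (\<lambda>x. u x * indicator Q x) = 0"
    unfolding bm_measure_def by (subst (asm) AE_density) (simp_all add: AE_count_space)
  have cube_0: "mixed_norm_of (\<lambda>x. u x * indicator (dyadic_cube n 0 m) x) = 0" for m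
    using bspec[OF null, of "dyadic_cube n 0 m"] measure_dyadic_cube_pos[of n 0 m]
    by (auto simp: dyadic_cubes_def)
  let ?I = "PiE {1..n} (\<lambda>_. UNIV :: int set)"
  have "AE x in lebesgue_n n. u x * indicator (dyadic_cube n 0 m) x = 0" for m
    by (rule mixed_norm_of_eq_0[OF cutoff_measurable[OF _ u] cube_0]) (auto simp: dyadic_cubes_def)
  then have "AE x in lebesgue_n n. \<forall>m\<in>?I. u x * indicator (dyadic_cube n 0 m) x = 0"
    by (intro AE_ball_countable' countable_PiE) simp_all
  then show "AE x in lebesgue_n n. u x = 0"
  proof (rule AE_mp[OF _ AE_I2[OF impI]])
    fix x assume x: "x \<in> space (lebesgue_n n)"
      and *: "\<forall>m\<in>?I. u x * indicator (dyadic_cube n 0 m) x = 0"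
    define m where "m = (\<lambda>i\<in>{1..n}. \<lfloor>x i\<rfloor>)"
    have "x \<in> PiE {1..n} (\<lambda>_. UNIV)" using x by (simp add: lebesgue_n_def space_PiM)
    then have "x \<in> dyadic_cube n 0 m"
      unfolding dyadic_cube_def m_def by (auto simp: PiE_iff)
    moreover have "m \<in> ?I" by (simp add: m_def)
    ultimately show "u x = 0" using * by (auto simp: indicator_def)
  qed
qed

lemma bourgain_morrey_norm_eq:
  assumes r: "1 < r"
  shows "bourgain_morrey_norm n p t r f = bm_norm t r (\<lambda>x. ennreal (cmod (f x)))"
proof -
  have "mixed_Lp_norm n p (\<lambda>x. f x * indicator Q x) = mixed_norm_of (\<lambda>x. ennreal (cmod (f x)) * indicator Q x)" for Q
  proof -
    have "(\<lambda>x. ennreal (cmod (f x * indicator Q x))) = (\<lambda>x. ennreal (cmod (f x)) * indicator Q x)"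
      by (auto simp: indicator_def fun_eq_iff)
    then show ?thesis by (simp only: mixed_Lp_norm_def iterated_norm_eq_partial_norm)
  qed
  then show ?thesis
    unfolding bourgain_morrey_norm_def bm_norm_def Lp_norm_def bm_measure_def
    by (simp add: nn_integral_density infsum_eq_nn_integral countable_dyadic_cubes)
qed

lemma mixed_bourgain_morrey_eq:
  assumes r: "1 < r"
  shows "mixed_bourgain_morrey n p t r = function_space (lebesgue_n n) (bm_norm t r)"
proof -
  have cls: "ae_rel n `` {f} = ae_class (lebesgue_n n) f" for f
    by (auto simp: ae_rel_def ae_class_def)
  have norm: "bourgain_morrey_norm n p t r = (\<lambda>f. bm_norm t r (\<lambda>x. ennreal (cmod (f x))))"
    by (rule ext) (rule bourgain_morrey_norm_eq[OF r])
  show ?thesis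
    unfolding mixed_bourgain_morrey_def function_space_def bourgain_morrey_functions_def quotient_def
    by (simp only: cls norm) (simp add: UNION_singleton_eq_range)
qed

text \<open>The inequality for the mixed norm holds on each cube with one and the same \<open>C\<close>, since
  multiplication by an indicator produces another pair of measurable functions.\<close>

lemma bm_convexity:
  assumes r: "1 < r" and e: "0 < e"
  shows "\<exists>C>0. \<forall>f g. f \<in> borel_measurable (lebesgue_n n) \<longrightarrow> g \<in> borel_measurable (lebesgue_n n) \<longrightarrow>
    convexity_ineq r e C (bm_norm t r (\<lambda>x. ennreal (cmod (f x)))) (bm_norm t r (\<lambda>x. ennreal (cmod (g x))))
      (bm_norm t r (\<lambda>x. ennreal (cmod ((f x + g x) / 2)))) (bm_norm t r (\<lambda>x. ennreal (cmod (f x - g x))))"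
proof -
  from mixed_norm_of_convexity[OF r e] obtain C where C: "0 < C" and
    ineq: "\<And>f g. f \<in> borel_measurable (lebesgue_n n) \<Longrightarrow> g \<in> borel_measurable (lebesgue_n n) \<Longrightarrow>
    convexity_ineq r e C (mixed_norm_of (\<lambda>x. ennreal (cmod (f x)))) (mixed_norm_of (\<lambda>x. ennreal (cmod (g x))))
      (mixed_norm_of (\<lambda>x. ennreal (cmod ((f x + g x) / 2)))) (mixed_norm_of (\<lambda>x. ennreal (cmod (f x - g x))))" by blast
  have "convexity_ineq r e C (bm_norm t r (\<lambda>x. ennreal (cmod (f x)))) (bm_norm t r (\<lambda>x. ennreal (cmod (g x))))
      (bm_norm t r (\<lambda>x. ennreal (cmod ((f x + g x) / 2)))) (bm_norm t r (\<lambda>x. ennreal (cmod (f x - g x))))"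
    if f: "f \<in> borel_measurable (lebesgue_n n)" and g: "g \<in> borel_measurable (lebesgue_n n)" for f g
    unfolding bm_norm_def
  proof (rule convexity_ineq_Lp_norm)
    fix Q assume "Q \<in> space (bm_measure t r)"
    then have Q: "Q \<in> sets (lebesgue_n n)" by (intro cube_in_sets) simp
    have meas: "(\<lambda>x. h x * indicator Q x) \<in> borel_measurable (lebesgue_n n)"
      if "h \<in> borel_measurable (lebesgue_n n)" for h :: "(nat \<Rightarrow> real) \<Rightarrow> complex"
      using that Q by (intro borel_measurable_times borel_measurable_indicator)
    have cut: "ennreal (cmod (f x * indicator Q x)) = ennreal (cmod (f x)) * indicator Q x"
      "ennreal (cmod (g x * indicator Q x)) = ennreal (cmod (g x)) * indicator Q x"
      "ennreal (cmod ((f x * indicator Q x + g x * indicator Q x) / 2)) = ennreal (cmod ((f x + g x) / 2)) * indicator Q x"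
      "ennreal (cmod (f x * indicator Q x - g x * indicator Q x)) = ennreal (cmod (f x - g x)) * indicator Q x" for x
      by (auto simp: indicator_def)
    show "convexity_ineq r e C (mixed_norm_of (\<lambda>x. ennreal (cmod (f x)) * indicator Q x))
        (mixed_norm_of (\<lambda>x. ennreal (cmod (g x)) * indicator Q x))
        (mixed_norm_of (\<lambda>x. ennreal (cmod ((f x + g x) / 2)) * indicator Q x))
        (mixed_norm_of (\<lambda>x. ennreal (cmod (f x - g x)) * indicator Q x))"
      using ineq[OF meas[OF f] meas[OF g]] unfolding cut .
  qed (use r in simp_all)
  with C show ?thesis by (intro exI[of _ C] conjI allI impI)
qed

theorem reflexive_mixed_bourgain_morrey:
  assumes r: "1 < r"
  shows "reflexive_space (mixed_bourgain_morrey n p t r)"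
  unfolding mixed_bourgain_morrey_eq[OF r]
proof (rule function_norm.reflexive_if_power_convex[OF function_norm_bm[OF r]])
  show "0 < r" using r by simp
qed (rule bm_convexity[OF r, unfolded convexity_ineq_def])

end

text \<open>The chain of inequalities enters through \<open>1 < r\<close>, which makes the \<open>\<ell>\<^sup>r\<close> sum over the
  cubes uniformly convex.\<close>

theorem corollary5p14:
  fixes n :: nat and p :: "nat \<Rightarrow> real" and t r :: real
  assumes "n \<ge> 1"
    and "\<And>i. i \<in> {1..n} \<Longrightarrow> 1 < p i"
    and "1 < real n / (\<Sum>i=1..n. 1 / p i)"
    and "real n / (\<Sum>i=1..n. 1 / p i) < t"
    and "t < r"
  shows "reflexive_space (mixed_bourgain_morrey n p t r)"
proof -
  interpret mixed_norm n p using assms(2) by unfold_locales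
  show ?thesis by (rule reflexive_mixed_bourgain_morrey) (use assms in simp)
qed

end
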